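(* For every $n\ge 1$ and every $b\in B_n$, the linear map $I_n:W^{\otimes n}\to\bigwedge(W_n\oplus W_n\oplus W_n)$ satisfies $$\Phi_n(b)\circ I_n = I_n\circ b_S^n(\hat b).$$
   Context: The base field is $\mathbb{C}(t_0^{1/2})$. $B_n$ is the braid group with Artin generators $\sigma_1,\dots,\sigma_{n-1}$. For $b=\sigma_{i_1}^{\varepsilon_1}\cdots\sigma_{i_p}^{\varepsilon_p}\in B_n$, $\hat b:=\sigma_{n-i_1}^{\varepsilon_1}\cdots\sigma_{n-i_p}^{\varepsilon_p}$ (so $b\mapsto\hat b$ is the group automorphism with $\hat\sigma_k=\sigma_{n-k}$). **The representation $b_S^n$.** Let $W$ have basis $e_1,\dots,e_8$; write $e_{ij}=e_i\otimes e_j$ and $Y=t_0^{1/2}-t_0^{-1/2}$. Put $$A=\begin{pmatrix}0&t_0^{-1/2}\\ t_0^{-1/2}&1-t_0^{-1}\end{pmatrix},\quad B=\begin{pmatrix}0&0&0&1\\0&0&1&Y\\0&1&0&Y\\1&Y&Y&Y^2\end{pmatrix},\quad C=\begin{pmatrix}0&0&0&0&0&0&0&1\\0&0&0&0&0&0&1&Y\\0&0&0&0&0&1&0&Y\\0&0&0&0&1&0&0&Y\\0&0&0&1&0&Y&Y&Y^2\\0&0&1&0&Y&0&Y&Y^2\\0&1&0&0&Y&Y&0&Y^2\\1&Y&Y&Y&Y^2&Y^2&Y^2&Y^3\end{pmatrix}.$$ $S$ is the automorphism of $W\otimes W$ that is the direct sum of the following blocks: - $\mathrm{diag}(1,-t_0^{-1},-t_0^{-1},-t_0^{-1},t_0^{-2},t_0^{-2},t_0^{-2},-t_0^{-3})$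 in basis $(e_{11},e_{22},\dots,e_{88})$; - $A$ in bases $(e_{12},e_{21})$, $(e_{13},e_{31})$, $(e_{14},e_{41})$; - $t_0^{-2}A$ in bases $(e_{78},e_{87})$, $(e_{68},e_{86})$, $(e_{58},e_{85})$; - $-t_0^{-1}A$ in bases $(e_{25},e_{52})$, $(e_{35},e_{53})$, $(e_{26},e_{62})$, $(e_{46},e_{64})$, $(e_{37},e_{73})$, $(e_{47},e_{74})$; - $t_0^{-1}B$ in bases $(e_{15},e_{23},e_{32},e_{51})$, $(e_{16},e_{24},e_{42},e_{61})$, $(e_{17},e_{34},e_{43},e_{71})$; - $-t_0^{-2}B$ in bases $(e_{48},e_{67},e_{76},e_{84})$, $(e_{38},e_{57},e_{75},e_{83})$, $(e_{28},e_{56},e_{65},e_{82})$; - $t_0^{-3/2}C$ in basis $(e_{18},e_{45},e_{36},e_{27},e_{72},e_{63},e_{54},e_{81})$. $S$ satisfies the Yang-Baxter equation, and $b_S^n:B_n\to GL(W^{\otimes n})$ is given by $b_S^n(\sigma_i)=\mathrm{id}_W^{\otimes i-1}\otimes S\otimes\mathrm{id}_W^{\otimes n-i-1}$. **The representation $\Phi_n$.** Take three $n$-dimensional spaces, all denoted $W_n$, with bases $(f_j)$, $(g_j)$, $(h_j)$, $1\le j\le n$. Let $F(\sigma_i)(f_i)=t_0^{-1/2}f_{i+1}$, $F(\sigma_i)(f_{i+1})=t_0^{-1/2}f_i+(1-t_0^{-1})f_{i+1}$, $F(\sigma_i)(f_j)=f_j$ otherwise; $G$ and $H$ are the representations given by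 the same formulas on $(g_j)$ and $(h_j)$ respectively. Then $\Phi_n:=\bigwedge(F\oplus G\oplus H)$ on $\bigwedge(W_n\oplus W_n\oplus W_n)$. **The map $I_n$.** The reference basis of $\bigwedge(W_n\oplus W_n\oplus W_n)$ consists of the elements $f_{i_1}\wedge\cdots\wedge f_{i_p}\wedge g_{j_1}\wedge\cdots\wedge g_{j_m}\wedge h_{k_1}\wedge\cdots\wedge h_{k_q}$ with $i_1<\cdots<i_p$, $j_1<\cdots<j_m$, $k_1<\cdots<k_q$. For a wedge product $u$ of distinct elements of $\{f_j,g_j,h_j\}$, $Reord(u)$ is the reference basis element with the same set of factors (the factors are rearranged with no sign). Set $I_1(e_1)=1$, $I_1(e_2)=f_1$, $I_1(e_3)=g_1$, $I_1(e_4)=h_1$, $I_1(e_5)=f_1\wedge g_1$, $I_1(e_6)=f_1\wedge h_1$, $I_1(e_7)=g_1\wedge h_1$, $I_1(e_8)=f_1\wedge g_1\wedge h_1$. For $n\ge2$ and $x=e_{i_{n-1}}\otimes\cdots\otimes e_{i_1}$, $I_n$ is the linear map with $I_n(e_1\otimes x)=I_{n-1}(x)$, $I_n(e_2\otimes x)=Reord(I_{n-1}(x)\wedge f_n)$, $I_n(e_3\otimes x)=Reord(I_{n-1}(x)\wedge g_n)$, $I_n(e_4\otimes x)=I_{n-1}(x)\wedge h_n$, $I_n(e_5\otimes x)=Reord(I_{n-1}(x)\wedge f_n\wedge g_n)$, $I_n(e_6\otimes x)=Reord(I_{n-1}(x)\wedge f_n\wedge h_n)$, $I_n(e_7\otimes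 x)=Reord(I_{n-1}(x)\wedge g_n\wedge h_n)$, $I_n(e_8\otimes x)=Reord(I_{n-1}(x)\wedge f_n\wedge g_n\wedge h_n)$. *)

theory Defs
  imports
    "HOL-Algebra.Group"
    "HOL-Computational_Algebra.Fraction_Field"
    "HOL-Computational_Algebra.Polynomial"
    "HOL-Library.Poly_Mapping"
begin

section \<open>The base field\<close>

type_synonym K = "complex poly fract"

text \<open>The indeterminate of the base field is \<open>rt\<close>, the chosen square root of \<open>t\<^sub>0\<close>.\<close>

definition rt :: K where "rt = Fraction_Field.Fract [:0, 1:] 1"
definition t0 :: K where "t0 = rt ^ 2"
definition Y :: K where "Y = rt - 1 / rt"


section \<open>Vector spaces with a basis\<close>

text \<open>A vector space with basis indexed by \<open>B :: 'b set\<close> is realised inside the finitely supported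
  functions on \<open>'b\<close>, as \<open>free_space B\<close>; the basis vector of index \<open>x\<close> is \<open>bvec x\<close>.\<close>

type_synonym 'b fvec = "'b \<Rightarrow>\<^sub>0 K"

definition bvec :: "'b \<Rightarrow> 'b fvec" where
  "bvec x = Poly_Mapping.single x 1"

definition scale :: "K \<Rightarrow> 'b fvec \<Rightarrow> 'b fvec" where
  "scale c v = Poly_Mapping.map ((*) c) v"

definition free_space :: "'b set \<Rightarrow> 'b fvec set" where
  "free_space B = {v. Poly_Mapping.keys v \<subseteq> B}"

text \<open>The linear map taking prescribed values on basis vectors.\<close>

definition lin_ext :: "('b \<Rightarrow> 'c fvec) \<Rightarrow> 'b fvec \<Rightarrow> 'c fvec" where
  "lin_ext \<phi> v = (\<Sum>x\<in>Poly_Mapping.keys v. scale (Poly_Mapping.lookup v x) (\<phi> x))"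

lemma lookup_scale [simp]: "Poly_Mapping.lookup (scale c v) x = c * Poly_Mapping.lookup v x"
  by (simp add: scale_def Poly_Mapping.map.rep_eq when_def)

lemma vector_space_scale: "vector_space (scale :: K \<Rightarrow> 'b fvec \<Rightarrow> 'b fvec)"
  by unfold_locales (auto intro!: poly_mapping_eqI simp: lookup_add algebra_simps)

lemma module_scale: "module (scale :: K \<Rightarrow> 'b fvec \<Rightarrow> 'b fvec)"
  using vector_space_scale by (simp add: module_iff_vector_space)

lemma keys_scale: "Poly_Mapping.keys (scale c v) \<subseteq> Poly_Mapping.keys v"
  by (auto simp: in_keys_iff)

lemma free_space_zero: "0 \<in> free_space B"
  by (simp add: free_space_def)

lemma free_space_add: "u \<in> free_space B \<Longrightarrow> v \<in> free_space B \<Longrightarrow> u + v \<in> free_space B"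
  using Poly_Mapping.keys_add[of u v] by (auto simp: free_space_def)

lemma free_space_scale: "v \<in> free_space B \<Longrightarrow> scale c v \<in> free_space B"
  using keys_scale[of c v] by (auto simp: free_space_def)

lemma free_space_eq_span: "free_space (B :: 'b set) = module.span scale (bvec ` B)"
proof -
  interpret vector_space "scale :: K \<Rightarrow> 'b fvec \<Rightarrow> 'b fvec" by (rule vector_space_scale)
  show ?thesis
  proof
    show "free_space B \<subseteq> span (bvec ` B)"
    proof
      fix v :: "'b fvec" assume v: "v \<in> free_space B"
      have "v = lin_ext bvec v"
      proof (rule poly_mapping_eqI)
        fix k
        show "Poly_Mapping.lookup v k = Poly_Mapping.lookup (lin_ext bvec v) k"
          by (auto simp: lin_ext_def bvec_def lookup_sum lookup_single when_def in_keys_iff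
              if_distrib cong: if_cong)
      qed
      also have "lin_ext bvec v = (\<Sum>x\<in>Poly_Mapping.keys v. scale (Poly_Mapping.lookup v x) (bvec x))"
        by (simp add: lin_ext_def)
      also have "\<dots> \<in> span (bvec ` B)"
        using v by (intro span_sum span_scale span_base) (auto simp: free_space_def)
      finally show "v \<in> span (bvec ` B)" .
    qed
    have "subspace (free_space B)"
      by (auto simp: subspace_def free_space_zero free_space_add free_space_scale)
    then show "span (bvec ` B) \<subseteq> free_space B"
      by (intro span_minimal) (auto simp: free_space_def bvec_def)
  qed
qed

lemma lin_ext_bvec [simp]: "lin_ext \<phi> (bvec x) = \<phi> x"
  by (auto simp: lin_ext_def bvec_def intro!: poly_mapping_eqI)

lemma lin_ext_superset:
  assumes "finite A" "Poly_Mapping.keys v \<subseteq> A"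
  shows "lin_ext \<phi> v = (\<Sum>x\<in>A. scale (Poly_Mapping.lookup v x) (\<phi> x))"
  unfolding lin_ext_def using assms
  by (intro sum.mono_neutral_left) (auto simp: in_keys_iff intro!: poly_mapping_eqI)

lemma lin_ext_add: "lin_ext \<phi> (u + v) = lin_ext \<phi> u + lin_ext \<phi> v"
proof -
  let ?A = "Poly_Mapping.keys u \<union> Poly_Mapping.keys v"
  show ?thesis
    using Poly_Mapping.keys_add[of u v]
    by (simp add: lin_ext_superset[where A = ?A] lookup_add sum.distrib
        module.scale_left_distrib[OF module_scale])
qed

lemma lin_ext_scale: "lin_ext \<phi> (scale c v) = scale c (lin_ext \<phi> v)"
  using keys_scale[of c v]
  by (subst lin_ext_superset[where A = "Poly_Mapping.keys v"])
     (auto simp: lin_ext_def module.scale_sum_right[OF module_scale]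
        module.scale_scale[OF module_scale])


subsection \<open>The group of linear automorphisms\<close>

definition linear_on :: "'b fvec set \<Rightarrow> ('b fvec \<Rightarrow> 'c fvec) \<Rightarrow> bool" where
  "linear_on V T \<longleftrightarrow> (\<forall>x\<in>V. \<forall>y\<in>V. T (x + y) = T x + T y) \<and> (\<forall>c. \<forall>x\<in>V. T (scale c x) = scale c (T x))"

definition GL :: "'b fvec set \<Rightarrow> ('b fvec \<Rightarrow> 'b fvec) monoid" where
  "GL V = \<lparr>carrier = {T \<in> extensional V. bij_betw T V V \<and> linear_on V T},
           monoid.mult = (\<lambda>T U. compose V T U), one = (\<lambda>x\<in>V. x)\<rparr>"

lemma group_GL:
  fixes B :: "'b set"
  shows "group (GL (free_space B))"
proof (rule groupI)
  let ?V = "free_space B"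
  show "\<one>\<^bsub>GL ?V\<^esub> \<in> carrier (GL ?V)"
    by (auto simp: GL_def linear_on_def bij_betw_def inj_on_def free_space_add free_space_scale)
  show "T \<otimes>\<^bsub>GL ?V\<^esub> U \<in> carrier (GL ?V)"
    if "T \<in> carrier (GL ?V)" "U \<in> carrier (GL ?V)" for T U
    using that bij_betw_compose[of U ?V ?V T ?V] bij_betwE[of U ?V ?V]
    by (auto simp: GL_def linear_on_def compose_def free_space_add free_space_scale)
  show "T \<otimes>\<^bsub>GL ?V\<^esub> U \<otimes>\<^bsub>GL ?V\<^esub> X = T \<otimes>\<^bsub>GL ?V\<^esub> (U \<otimes>\<^bsub>GL ?V\<^esub> X)"
    if "T \<in> carrier (GL ?V)" "U \<in> carrier (GL ?V)" "X \<in> carrier (GL ?V)" for T U X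
    using that compose_assoc[of X ?V ?V T U] bij_betwE[of X ?V ?V]
    by (auto simp: GL_def compose_def)
  show "\<one>\<^bsub>GL ?V\<^esub> \<otimes>\<^bsub>GL ?V\<^esub> T = T" if "T \<in> carrier (GL ?V)" for T
    using that bij_betwE[of T ?V ?V]
    by (auto simp: GL_def compose_def extensional_def restrict_def fun_eq_iff)
  show "\<exists>U\<in>carrier (GL ?V). U \<otimes>\<^bsub>GL ?V\<^esub> T = \<one>\<^bsub>GL ?V\<^esub>" if T: "T \<in> carrier (GL ?V)" for T
  proof
    let ?U = "\<lambda>x\<in>?V. inv_into ?V T x"
    have bij: "bij_betw T ?V ?V" and lin: "linear_on ?V T"
      using T by (auto simp: GL_def)
    have inV: "inv_into ?V T x \<in> ?V" if "x \<in> ?V" for x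
      using bij that by (metis bij_betw_def inv_into_into)
    have TU: "T (inv_into ?V T x) = x" if "x \<in> ?V" for x
      using bij that by (metis bij_betw_inv_into_right)
    have UT: "inv_into ?V T (T x) = x" if "x \<in> ?V" for x
      using bij that by (metis bij_betw_inv_into_left)
    have add: "inv_into ?V T (x + y) = inv_into ?V T x + inv_into ?V T y"
      if "x \<in> ?V" "y \<in> ?V" for x y
      using that lin UT[of "inv_into ?V T x + inv_into ?V T y"]
      by (simp add: linear_on_def inV TU free_space_add)
    have sc: "inv_into ?V T (scale c x) = scale c (inv_into ?V T x)" if "x \<in> ?V" for c x
      using that lin UT[of "scale c (inv_into ?V T x)"]
      by (simp add: linear_on_def inV TU free_space_scale)
    have "bij_betw ?U ?V ?V"
      using bij_betw_inv_into[OF bij] by (subst bij_betw_cong) auto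
    then show "?U \<in> carrier (GL ?V)"
      by (auto simp: GL_def linear_on_def add sc free_space_add free_space_scale)
    show "?U \<otimes>\<^bsub>GL ?V\<^esub> T = \<one>\<^bsub>GL ?V\<^esub>"
      using bij_betwE[OF bij] by (auto simp: GL_def compose_def UT)
  qed
qed


section \<open>Braid groups\<close>

text \<open>\<open>B\<^sub>n\<close> is the group of words in \<open>\<sigma>\<^sub>i\<^sup>\<plusminus>\<^sup>1\<close>, \<open>1 \<le> i < n\<close>, modulo the congruence generated by
  free cancellation and Artin's relations. The letter \<open>(i, True)\<close> is \<open>\<sigma>\<^sub>i\<close> and \<open>(i, False)\<close> is its
  inverse.\<close>

definition braid_words :: "nat \<Rightarrow> (nat \<times> bool) list set" where
  "braid_words n = lists ({1..<n} \<times> UNIV)"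

inductive braid_cong :: "nat \<Rightarrow> (nat \<times> bool) list \<Rightarrow> (nat \<times> bool) list \<Rightarrow> bool" for n where
  refl: "w \<in> braid_words n \<Longrightarrow> braid_cong n w w"
| sym: "braid_cong n u v \<Longrightarrow> braid_cong n v u"
| trans: "braid_cong n u v \<Longrightarrow> braid_cong n v w \<Longrightarrow> braid_cong n u w"
| append: "braid_cong n u u' \<Longrightarrow> braid_cong n v v' \<Longrightarrow> braid_cong n (u @ v) (u' @ v')"
| cancel: "1 \<le> i \<Longrightarrow> i < n \<Longrightarrow> braid_cong n [(i, \<epsilon>), (i, \<not> \<epsilon>)] []"
| far: "1 \<le> i \<Longrightarrow> i + 1 < j \<Longrightarrow> j < n \<Longrightarrow>
    braid_cong n [(i, True), (j, True)] [(j, True), (i, True)]"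
| braid: "1 \<le> i \<Longrightarrow> i + 1 < n \<Longrightarrow>
    braid_cong n [(i, True), (i + 1, True), (i, True)] [(i + 1, True), (i, True), (i + 1, True)]"

definition braid_rel :: "nat \<Rightarrow> ((nat \<times> bool) list \<times> (nat \<times> bool) list) set" where
  "braid_rel n = {(u, v). braid_cong n u v}"

definition braid_class :: "nat \<Rightarrow> (nat \<times> bool) list \<Rightarrow> (nat \<times> bool) list set" where
  "braid_class n w = braid_rel n `` {w}"

definition braid_group :: "nat \<Rightarrow> (nat \<times> bool) list set monoid" where
  "braid_group n = \<lparr>carrier = braid_words n // braid_rel n,
     monoid.mult = (\<lambda>X Z. \<Union>u\<in>X. \<Union>v\<in>Z. braid_class n (u @ v)), one = braid_class n []\<rparr>"

definition sigma :: "nat \<Rightarrow> nat \<Rightarrow> (nat \<times> bool) list set" where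
  "sigma n i = braid_class n [(i, True)]"

text \<open>The homomorphism from a braid group to a group \<open>G\<close> sending \<open>\<sigma>\<^sub>i\<close> to \<open>g i\<close>; see
  \<open>braid_lift_hom\<close> below.\<close>

definition word_eval :: "('a, 'm) monoid_scheme \<Rightarrow> (nat \<Rightarrow> 'a) \<Rightarrow> (nat \<times> bool) list \<Rightarrow> 'a" where
  "word_eval G g w = foldr (\<lambda>(i, \<epsilon>) a. (if \<epsilon> then g i else inv\<^bsub>G\<^esub> (g i)) \<otimes>\<^bsub>G\<^esub> a) w \<one>\<^bsub>G\<^esub>"

definition braid_lift ::
    "('a, 'm) monoid_scheme \<Rightarrow> (nat \<Rightarrow> 'a) \<Rightarrow> (nat \<times> bool) list set \<Rightarrow> 'a" where
  "braid_lift G g b = the_elem (word_eval G g ` b)"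

definition hat :: "nat \<Rightarrow> (nat \<times> bool) list set \<Rightarrow> (nat \<times> bool) list set" where
  "hat n = braid_lift (braid_group n) (\<lambda>i. sigma n (n - i))"

lemma braid_cong_words: "braid_cong n u v \<Longrightarrow> u \<in> braid_words n \<and> v \<in> braid_words n"
  by (induction rule: braid_cong.induct) (auto simp: braid_words_def)

lemma equiv_braid_rel: "equiv (braid_words n) (braid_rel n)"
  using braid_cong_words
  by (auto simp: equiv_def refl_on_def sym_def trans_def braid_rel_def
      intro: braid_cong.refl braid_cong.sym braid_cong.trans)

lemma braid_class_eq_iff:
  "u \<in> braid_words n \<Longrightarrow> v \<in> braid_words n \<Longrightarrow> braid_class n u = braid_class n v \<longleftrightarrow> braid_cong n u v"
  unfolding braid_class_def using eq_equiv_class_iff[OF equiv_braid_rel, of u n v]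
  by (simp add: braid_rel_def)

lemma braid_class_carrier: "w \<in> braid_words n \<Longrightarrow> braid_class n w \<in> carrier (braid_group n)"
  by (auto simp: braid_group_def braid_class_def intro: quotientI)

lemma braid_carrierE:
  assumes "b \<in> carrier (braid_group n)"
  obtains w where "w \<in> braid_words n" "b = braid_class n w"
  using assms by (auto simp: braid_group_def braid_class_def elim!: quotientE)

lemma braid_mult_class:
  assumes "u \<in> braid_words n" "v \<in> braid_words n"
  shows "braid_class n u \<otimes>\<^bsub>braid_group n\<^esub> braid_class n v = braid_class n (u @ v)"
proof -
  have "braid_class n (u' @ v') = braid_class n (u @ v)"
    if "u' \<in> braid_class n u" "v' \<in> braid_class n v" for u' v'
  proof -
    have "braid_cong n (u @ v) (u' @ v')"
      using that by (auto simp: braid_class_def braid_rel_def intro: braid_cong.append)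
    then show ?thesis
      using braid_cong_words braid_class_eq_iff by metis
  qed
  moreover have "u \<in> braid_class n u" "v \<in> braid_class n v"
    using assms by (auto simp: braid_class_def braid_rel_def intro: braid_cong.refl)
  ultimately have "(\<Union>u'\<in>braid_class n u. \<Union>v'\<in>braid_class n v. braid_class n (u' @ v')) =
      braid_class n (u @ v)"
    by (metis (no_types, lifting) SUP_cong SUP_constant empty_iff)
  then show ?thesis
    by (simp add: braid_group_def)
qed

lemma group_braid_group: "group (braid_group n)"
proof (rule groupI)
  have app: "u @ v \<in> braid_words n" if "u \<in> braid_words n" "v \<in> braid_words n" for u v
    using that by (auto simp: braid_words_def)
  have nil: "[] \<in> braid_words n" by (simp add: braid_words_def)
  have one: "\<one>\<^bsub>braid_group n\<^esub> = braid_class n []" by (simp add: braid_group_def)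
  show "\<one>\<^bsub>braid_group n\<^esub> \<in> carrier (braid_group n)"
    using nil by (simp add: one braid_class_carrier)
  show "x \<otimes>\<^bsub>braid_group n\<^esub> y \<in> carrier (braid_group n)"
    if "x \<in> carrier (braid_group n)" "y \<in> carrier (braid_group n)" for x y
    using that by (auto elim!: braid_carrierE simp: braid_mult_class app intro!: braid_class_carrier)
  show "x \<otimes>\<^bsub>braid_group n\<^esub> y \<otimes>\<^bsub>braid_group n\<^esub> z = x \<otimes>\<^bsub>braid_group n\<^esub> (y \<otimes>\<^bsub>braid_group n\<^esub> z)"
    if "x \<in> carrier (braid_group n)" "y \<in> carrier (braid_group n)" "z \<in> carrier (braid_group n)"
    for x y z
    using that by (auto elim!: braid_carrierE simp: braid_mult_class app)
  show "\<one>\<^bsub>braid_group n\<^esub> \<otimes>\<^bsub>braid_group n\<^esub> x = x" if "x \<in> carrier (braid_group n)" for x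
    using that nil by (auto elim!: braid_carrierE simp: one braid_mult_class)
  have ex: "\<exists>v\<in>braid_words n. braid_cong n (v @ w) []" if "w \<in> braid_words n" for w
    using that
  proof (induction w)
    case Nil
    show ?case using nil by (auto intro!: bexI[of _ "[]"] braid_cong.refl)
  next
    case (Cons l w)
    obtain i e where l: "l = (i, e)" by force
    have i: "1 \<le> i" "i < n" and w: "w \<in> braid_words n"
      using Cons.prems by (auto simp: l braid_words_def)
    obtain v where v: "v \<in> braid_words n" "braid_cong n (v @ w) []"
      using Cons.IH[OF w] by blast
    have c: "braid_cong n [(i, \<not> e), (i, e)] []"
      using braid_cong.cancel[OF i, of "\<not> e"] by simp
    have "braid_cong n (v @ [(i, \<not> e), (i, e)] @ w) (v @ [] @ w)"
      using v w c by (intro braid_cong.append braid_cong.refl)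
    then have "braid_cong n ((v @ [(i, \<not> e)]) @ l # w) []"
      using v(2) by (auto simp: l intro: braid_cong.trans)
    moreover have "v @ [(i, \<not> e)] \<in> braid_words n"
      using v(1) i by (auto simp: braid_words_def)
    ultimately show ?case by blast
  qed
  show "\<exists>y\<in>carrier (braid_group n). y \<otimes>\<^bsub>braid_group n\<^esub> x = \<one>\<^bsub>braid_group n\<^esub>"
    if x: "x \<in> carrier (braid_group n)" for x
  proof -
    obtain w where w: "w \<in> braid_words n" "x = braid_class n w"
      using x by (rule braid_carrierE)
    obtain v where v: "v \<in> braid_words n" "braid_cong n (v @ w) []"
      using ex[OF w(1)] by blast
    then show ?thesis
      using w nil by (intro bexI[of _ "braid_class n v"])
        (auto simp: braid_mult_class one braid_class_eq_iff app braid_class_carrier)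
  qed
qed

lemma
  assumes "group G"
    and g: "\<And>i. 1 \<le> i \<Longrightarrow> i < n \<Longrightarrow> g i \<in> carrier G"
    and far: "\<And>i j. 1 \<le> i \<Longrightarrow> i + 1 < j \<Longrightarrow> j < n \<Longrightarrow> g i \<otimes>\<^bsub>G\<^esub> g j = g j \<otimes>\<^bsub>G\<^esub> g i"
    and braid: "\<And>i. 1 \<le> i \<Longrightarrow> i + 1 < n \<Longrightarrow>
      g i \<otimes>\<^bsub>G\<^esub> g (i + 1) \<otimes>\<^bsub>G\<^esub> g i = g (i + 1) \<otimes>\<^bsub>G\<^esub> g i \<otimes>\<^bsub>G\<^esub> g (i + 1)"
  shows braid_lift_class:
      "\<And>w. w \<in> braid_words n \<Longrightarrow> braid_lift G g (braid_class n w) = word_eval G g w"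
    and braid_lift_hom: "braid_lift G g \<in> hom (braid_group n) G"
    and braid_lift_sigma: "\<And>i. 1 \<le> i \<Longrightarrow> i < n \<Longrightarrow> braid_lift G g (sigma n i) = g i"
proof -
  interpret group G by fact
  have Nil [simp]: "word_eval G g [] = \<one>\<^bsub>G\<^esub>"
    and Cons [simp]: "\<And>i e w. word_eval G g ((i, e) # w) =
      (if e then g i else inv\<^bsub>G\<^esub> (g i)) \<otimes>\<^bsub>G\<^esub> word_eval G g w"
    by (simp_all add: word_eval_def)
  have cl: "w \<in> braid_words n \<Longrightarrow> word_eval G g w \<in> carrier G" for w
    by (induction w) (auto simp: braid_words_def g)
  have app: "u \<in> braid_words n \<Longrightarrow> v \<in> braid_words n \<Longrightarrow>
      word_eval G g (u @ v) = word_eval G g u \<otimes>\<^bsub>G\<^esub> word_eval G g v" for u v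
  proof (induction u)
    case (Cons l u)
    then have "u \<in> braid_words n" by (simp add: braid_words_def)
    with Cons cl[of u] cl[of v] g show ?case
      by (cases l) (auto simp: braid_words_def m_assoc)
  qed (simp add: cl)
  have cong: "braid_cong n u v \<Longrightarrow> word_eval G g u = word_eval G g v" for u v
  proof (induction rule: braid_cong.induct)
    case (append u u' v v')
    then show ?case by (metis app braid_cong_words)
  next
    case (far i j)
    then show ?case using assms(3)[of i j] by (simp add: g)
  next
    case (braid i)
    then show ?case using assms(4)[of i] by (simp add: g m_assoc)
  qed (auto simp: g)
  show lift: "braid_lift G g (braid_class n w) = word_eval G g w" if w: "w \<in> braid_words n" for w
  proof -
    have "w \<in> braid_class n w"
      using braid_cong.refl[OF w] by (simp add: braid_class_def braid_rel_def)
    moreover have "word_eval G g v = word_eval G g w" if "v \<in> braid_class n w" for v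
      using that cong[of w v] by (simp add: braid_class_def braid_rel_def)
    ultimately have "word_eval G g ` braid_class n w = {word_eval G g w}"
      by blast
    then show ?thesis by (simp add: braid_lift_def)
  qed
  show "braid_lift G g \<in> hom (braid_group n) G"
  proof (rule homI)
    fix x y assume "x \<in> carrier (braid_group n)" "y \<in> carrier (braid_group n)"
    then obtain u v where "u \<in> braid_words n" "x = braid_class n u"
      "v \<in> braid_words n" "y = braid_class n v"
      by (metis braid_carrierE)
    moreover from this have "u @ v \<in> braid_words n" by (auto simp: braid_words_def)
    ultimately show "braid_lift G g (x \<otimes>\<^bsub>braid_group n\<^esub> y) =
        braid_lift G g x \<otimes>\<^bsub>G\<^esub> braid_lift G g y"
      by (simp add: braid_mult_class lift app)
  qed (auto elim!: braid_carrierE simp: lift cl)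
  show "braid_lift G g (sigma n i) = g i" if "1 \<le> i" "i < n" for i
    using that by (simp add: sigma_def lift braid_words_def g)
qed

lemma
  shows hat_hom: "hat n \<in> hom (braid_group n) (braid_group n)"
    and hat_sigma: "\<And>i. 1 \<le> i \<Longrightarrow> i < n \<Longrightarrow> hat n (sigma n i) = sigma n (n - i)"
proof -
  let ?g = "\<lambda>i. sigma n (n - i)"
  have w: "1 \<le> i \<Longrightarrow> i < n \<Longrightarrow> [(n - i, True)] \<in> braid_words n" for i
    by (auto simp: braid_words_def)
  have w2: "1 \<le> i \<Longrightarrow> i < n \<Longrightarrow> 1 \<le> j \<Longrightarrow> j < n \<Longrightarrow>
      [(n - i, True), (n - j, True)] \<in> braid_words n" for i j
    by (auto simp: braid_words_def)
  have w3: "1 \<le> i \<Longrightarrow> i < n \<Longrightarrow> 1 \<le> j \<Longrightarrow> j < n \<Longrightarrow> 1 \<le> k \<Longrightarrow> k < n \<Longrightarrow>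
      [(n - i, True), (n - j, True), (n - k, True)] \<in> braid_words n" for i j k
    by (auto simp: braid_words_def)
  have g: "?g i \<in> carrier (braid_group n)" if "1 \<le> i" "i < n" for i
    using w[OF that] by (simp add: sigma_def braid_class_carrier)
  have far: "?g i \<otimes>\<^bsub>braid_group n\<^esub> ?g j = ?g j \<otimes>\<^bsub>braid_group n\<^esub> ?g i"
    if "1 \<le> i" "i + 1 < j" "j < n" for i j
    using that braid_cong.far[of "n - j" "n - i" n]
    by (simp add: sigma_def braid_mult_class w w2 braid_class_eq_iff braid_cong.sym)
  have braid: "?g i \<otimes>\<^bsub>braid_group n\<^esub> ?g (i + 1) \<otimes>\<^bsub>braid_group n\<^esub> ?g i =
      ?g (i + 1) \<otimes>\<^bsub>braid_group n\<^esub> ?g i \<otimes>\<^bsub>braid_group n\<^esub> ?g (i + 1)"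
    if "1 \<le> i" "i + 1 < n" for i
  proof -
    have "n - i = n - (i + 1) + 1" using that by simp
    then have "braid_cong n [(n - (i + 1), True), (n - i, True), (n - (i + 1), True)]
        [(n - i, True), (n - (i + 1), True), (n - i, True)]"
      using that braid_cong.braid[of "n - (i + 1)" n] by simp
    then show ?thesis
      using that w[of i] w[of "i + 1"]
      by (simp add: sigma_def braid_mult_class w2 w3 braid_class_eq_iff braid_cong.sym
          del: diff_Suc_Suc)
  qed
  note * = group_braid_group[of n] g far braid
  show "hat n \<in> hom (braid_group n) (braid_group n)"
    unfolding hat_def by (rule braid_lift_hom[of _ n ?g, OF *])
  show "\<And>i. 1 \<le> i \<Longrightarrow> i < n \<Longrightarrow> hat n (sigma n i) = sigma n (n - i)"
    unfolding hat_def by (rule braid_lift_sigma[of _ n ?g, OF *])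
qed


section \<open>The representation on tensor powers\<close>

text \<open>\<open>e\<^bsub>i\<^sub>1\<^esub> \<otimes> \<dots> \<otimes> e\<^bsub>i\<^sub>n\<^esub>\<close> is the basis vector indexed by the list \<open>[i\<^sub>1, \<dots>, i\<^sub>n]\<close>.\<close>

definition tensor_power :: "nat \<Rightarrow> nat list fvec set" where
  "tensor_power n = free_space {l. length l = n \<and> set l \<subseteq> {1..8}}"

definition tensor :: "nat list fvec \<Rightarrow> nat list fvec \<Rightarrow> nat list fvec" where
  "tensor u v = lin_ext (\<lambda>k. lin_ext (\<lambda>l. bvec (k @ l)) v) u"

text \<open>The tensor product of a linear map on the first \<open>k\<close> tensor factors and a linear map on the
  remaining ones.\<close>

definition tensor_map :: "nat \<Rightarrow> (nat list fvec \<Rightarrow> nat list fvec) \<Rightarrow>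
    (nat list fvec \<Rightarrow> nat list fvec) \<Rightarrow> nat list fvec \<Rightarrow> nat list fvec" where
  "tensor_map k T U = lin_ext (\<lambda>l. tensor (T (bvec (take k l))) (U (bvec (drop k l))))"

text \<open>Matrices are lists of rows.\<close>

definition matA :: "K list list" where
  "matA = [[0, 1 / rt],
           [1 / rt, 1 - 1 / t0]]"

definition matB :: "K list list" where
  "matB = [[0, 0, 0, 1],
           [0, 0, 1, Y],
           [0, 1, 0, Y],
           [1, Y, Y, Y ^ 2]]"

definition matC :: "K list list" where
  "matC = [[0, 0, 0, 0, 0, 0, 0, 1],
           [0, 0, 0, 0, 0, 0, 1, Y],
           [0, 0, 0, 0, 0, 1, 0, Y],
           [0, 0, 0, 0, 1, 0, 0, Y],
           [0, 0, 0, 1, 0, Y, Y, Y ^ 2],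
           [0, 0, 1, 0, Y, 0, Y, Y ^ 2],
           [0, 1, 0, 0, Y, Y, 0, Y ^ 2],
           [1, Y, Y, Y, Y ^ 2, Y ^ 2, Y ^ 2, Y ^ 3]]"

definition diag_mat_list :: "K list \<Rightarrow> K list list" where
  "diag_mat_list ds =
     map (\<lambda>i. map (\<lambda>j. if i = j then ds ! i else 0) [0..<length ds]) [0..<length ds]"

text \<open>The diagonal blocks of \<open>S\<close>: a scalar, a matrix, and the basis vectors \<open>e\<^sub>i\<^sub>j\<close> it acts on.\<close>

definition S_blocks :: "(K \<times> K list list \<times> nat list list) list" where
  "S_blocks =
    [(1, diag_mat_list [1, - (1 / t0), - (1 / t0), - (1 / t0),
                        1 / t0 ^ 2, 1 / t0 ^ 2, 1 / t0 ^ 2, - (1 / t0 ^ 3)],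
        [[1,1], [2,2], [3,3], [4,4], [5,5], [6,6], [7,7], [8,8]]),
     (1, matA, [[1,2], [2,1]]),
     (1, matA, [[1,3], [3,1]]),
     (1, matA, [[1,4], [4,1]]),
     (1 / t0 ^ 2, matA, [[7,8], [8,7]]),
     (1 / t0 ^ 2, matA, [[6,8], [8,6]]),
     (1 / t0 ^ 2, matA, [[5,8], [8,5]]),
     (- (1 / t0), matA, [[2,5], [5,2]]),
     (- (1 / t0), matA, [[3,5], [5,3]]),
     (- (1 / t0), matA, [[2,6], [6,2]]),
     (- (1 / t0), matA, [[4,6], [6,4]]),
     (- (1 / t0), matA, [[3,7], [7,3]]),
     (- (1 / t0), matA, [[4,7], [7,4]]),
     (1 / t0, matB, [[1,5], [2,3], [3,2], [5,1]]),
     (1 / t0, matB, [[1,6], [2,4], [4,2], [6,1]]),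
     (1 / t0, matB, [[1,7], [3,4], [4,3], [7,1]]),
     (- (1 / t0 ^ 2), matB, [[4,8], [6,7], [7,6], [8,4]]),
     (- (1 / t0 ^ 2), matB, [[3,8], [5,7], [7,5], [8,3]]),
     (- (1 / t0 ^ 2), matB, [[2,8], [5,6], [6,5], [8,2]]),
     (1 / rt ^ 3, matC, [[1,8], [4,5], [3,6], [2,7], [7,2], [6,3], [5,4], [8,1]])]"

definition S :: "nat list fvec \<Rightarrow> nat list fvec" where
  "S = lin_ext (\<lambda>q. \<Sum>(c, M, bs) \<leftarrow> S_blocks. \<Sum>j<length bs. \<Sum>i<length bs.
         if bs ! j = q then scale (c * M ! i ! j) (bvec (bs ! i)) else 0)"

text \<open>\<open>\<sigma>\<^sub>i\<close> acts by \<open>S\<close> on the tensor factors \<open>i\<close> and \<open>i + 1\<close>. By \<open>braid_lift_hom\<close> this is a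
  representation as soon as \<open>S\<close> is invertible and satisfies the Yang-Baxter equation, which is not
  proved in this theory.\<close>

definition bS :: "nat \<Rightarrow> (nat \<times> bool) list set \<Rightarrow> nat list fvec \<Rightarrow> nat list fvec" where
  "bS n = braid_lift (GL (tensor_power n))
     (\<lambda>i. restrict (tensor_map (i - 1) id (tensor_map 2 S id)) (tensor_power n))"


section \<open>The exterior representation\<close>

datatype gen = Fg nat | Gg nat | Hg nat

text \<open>The order of factors in the reference basis: all \<open>f\<close>'s, then all \<open>g\<close>'s, then all \<open>h\<close>'s.\<close>

fun gen_key :: "gen \<Rightarrow> nat \<times> nat" where
  "gen_key (Fg j) = (0, j)"
| "gen_key (Gg j) = (1, j)"
| "gen_key (Hg j) = (2, j)"

instantiation gen :: linorder
begin
definition "x < y \<longleftrightarrow> (gen_key x, gen_key y) \<in> less_than <*lex*> less_than" for x y :: gen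
definition "x \<le> y \<longleftrightarrow> x = y \<or> x < y" for x y :: gen
instance
proof
  fix x y z :: gen
  show "(x < y) = (x \<le> y \<and> \<not> y \<le> x)" "x \<le> x"
    "x \<le> y \<Longrightarrow> y \<le> z \<Longrightarrow> x \<le> z" "x \<le> y \<Longrightarrow> y \<le> x \<Longrightarrow> x = y" "x \<le> y \<or> y \<le> x"
    by (cases x; cases y; cases z; force simp: less_gen_def less_eq_gen_def)+
qed
end

text \<open>The exterior algebra on the generators: the basis vector indexed by a finite set \<open>A\<close> is the
  wedge product of the elements of \<open>A\<close> in increasing order, that is, a reference basis vector
  (see \<open>bvec_eq_wedge_list\<close> below). The sign in \<open>wedge\<close> is that of the shuffle sorting the
  concatenation of \<open>A\<close> and \<open>B\<close>.\<close>

definition exterior :: "nat \<Rightarrow> gen set fvec set" where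
  "exterior n = free_space {A. A \<subseteq> Fg ` {1..n} \<union> Gg ` {1..n} \<union> Hg ` {1..n}}"

definition wedge :: "gen set fvec \<Rightarrow> gen set fvec \<Rightarrow> gen set fvec" where
  "wedge u v = lin_ext (\<lambda>A. lin_ext (\<lambda>B.
     if A \<inter> B = {} then scale ((- 1) ^ card {(a, b) \<in> A \<times> B. b < a}) (bvec (A \<union> B)) else 0) v) u"

definition wedge_list :: "gen set fvec list \<Rightarrow> gen set fvec" where
  "wedge_list us = foldr wedge us (bvec {})"

definition deg1 :: "gen fvec \<Rightarrow> gen set fvec" where
  "deg1 = lin_ext (\<lambda>x. bvec {x})"

text \<open>The algebra endomorphism induced by a linear map on the generators.\<close>

definition exterior_map :: "(gen fvec \<Rightarrow> gen fvec) \<Rightarrow> gen set fvec \<Rightarrow> gen set fvec" where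
  "exterior_map T = lin_ext (\<lambda>A. wedge_list (map (\<lambda>x. deg1 (T (bvec x))) (sorted_list_of_set A)))"

lemma wedge_generators:
  "wedge (bvec {x}) (bvec {x}) = 0"
  "wedge (bvec {x}) (bvec {y}) = scale (- 1) (wedge (bvec {y}) (bvec {x}))"
proof -
  show "wedge (bvec {x}) (bvec {x}) = 0" by (simp add: wedge_def)
  have *: "{(a, b). a = u \<and> b = v \<and> b < a} = (if v < u then {(u, v)} else {})" for u v :: gen
    by auto
  show "wedge (bvec {x}) (bvec {y}) = scale (- 1) (wedge (bvec {y}) (bvec {x}))"
    by (cases x y rule: linorder_cases)
       (auto simp: wedge_def * insert_commute intro!: poly_mapping_eqI)
qed

lemma bvec_eq_wedge_list:
  "finite A \<Longrightarrow> bvec A = wedge_list (map (\<lambda>x. bvec {x}) (sorted_list_of_set A))"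
proof -
  have "sorted xs \<Longrightarrow> distinct xs \<Longrightarrow> bvec (set xs) = wedge_list (map (\<lambda>x. bvec {x}) xs)"
    for xs :: "gen list"
  proof (induction xs)
    case (Cons x xs)
    have "{(a, b). a = x \<and> b \<in> set xs \<and> b < a} = {}"
      using Cons.prems by auto
    then have inv: "card {(a, b). a = x \<and> b \<in> set xs \<and> b < a} = 0"
      by (simp only: card.empty)
    have "wedge_list (map (\<lambda>x. bvec {x}) (x # xs)) = wedge (bvec {x}) (bvec (set xs))"
      using Cons by (simp add: wedge_list_def)
    also have "\<dots> = scale 1 (bvec (set (x # xs)))"
      using Cons.prems inv by (simp add: wedge_def)
    finally show ?case by (auto intro!: poly_mapping_eqI)
  qed (simp add: wedge_list_def)
  then show "finite A \<Longrightarrow> ?thesis"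
    by (metis set_sorted_list_of_set sorted_sorted_list_of_set distinct_sorted_list_of_set)
qed

text \<open>\<open>W\<^sub>n\<close> with its basis \<open>(c j)\<close>, where \<open>c\<close> is one of \<open>Fg\<close>, \<open>Gg\<close>, \<open>Hg\<close>, and the
  representation \<open>F\<close>, \<open>G\<close>, \<open>H\<close> respectively of the braid group on it.\<close>

definition Wn :: "(nat \<Rightarrow> gen) \<Rightarrow> nat \<Rightarrow> gen fvec set" where
  "Wn c n = free_space (c ` {1..n})"

definition burau_gen :: "(nat \<Rightarrow> gen) \<Rightarrow> nat \<Rightarrow> gen fvec \<Rightarrow> gen fvec" where
  "burau_gen c i = lin_ext (\<lambda>x.
     if x = c i then scale (1 / rt) (bvec (c (i + 1)))
     else if x = c (i + 1) then scale (1 / rt) (bvec (c i)) + scale (1 - 1 / t0) (bvec (c (i + 1)))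
     else bvec x)"

definition burau :: "(nat \<Rightarrow> gen) \<Rightarrow> nat \<Rightarrow> (nat \<times> bool) list set \<Rightarrow> gen fvec \<Rightarrow> gen fvec" where
  "burau c n = braid_lift (GL (Wn c n)) (\<lambda>i. restrict (burau_gen c i) (Wn c n))"

definition direct_sum :: "(gen fvec \<Rightarrow> gen fvec) \<Rightarrow> (gen fvec \<Rightarrow> gen fvec) \<Rightarrow>
    (gen fvec \<Rightarrow> gen fvec) \<Rightarrow> gen fvec \<Rightarrow> gen fvec" where
  "direct_sum T U V = lin_ext (\<lambda>x. case x of Fg j \<Rightarrow> T (bvec x) | Gg j \<Rightarrow> U (bvec x) | Hg j \<Rightarrow> V (bvec x))"

definition Phi :: "nat \<Rightarrow> (nat \<times> bool) list set \<Rightarrow> gen set fvec \<Rightarrow> gen set fvec" where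
  "Phi n b = restrict (exterior_map (direct_sum (burau Fg n b) (burau Gg n b) (burau Hg n b))) (exterior n)"


section \<open>The intertwiner\<close>

text \<open>A wedge product of distinct generators is plus or minus a reference basis vector, so that it
  has a single key, namely its set of factors.\<close>

definition reord :: "gen set fvec \<Rightarrow> gen set fvec" where
  "reord u = bvec (the_elem (Poly_Mapping.keys u))"

definition new_factors :: "nat \<Rightarrow> nat \<Rightarrow> gen set fvec" where
  "new_factors i n = wedge_list (map (\<lambda>x. bvec {x})
     ([[], [Fg n], [Gg n], [Hg n], [Fg n, Gg n], [Fg n, Hg n], [Gg n, Hg n], [Fg n, Gg n, Hg n]]
      ! (i - 1)))"

text \<open>The leftmost tensor factor of \<open>e\<^bsub>i\<^sub>n\<^esub> \<otimes> \<dots> \<otimes> e\<^bsub>i\<^sub>1\<^esub>\<close> contributes the generators of index \<open>n\<close>.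
  The value at the empty list is irrelevant.\<close>

fun I_basis :: "nat list \<Rightarrow> gen set fvec" where
  "I_basis [] = 0"
| "I_basis [i] = new_factors i 1"
| "I_basis (i # j # x) =
     (let u = wedge (I_basis (j # x)) (new_factors i (length (i # j # x)))
      in if i = 1 \<or> i = 4 then u else reord u)"

definition I_map :: "nat \<Rightarrow> nat list fvec \<Rightarrow> gen set fvec" where
  "I_map n = restrict (lin_ext I_basis) (tensor_power n)"

end

theory Submission
  imports Defs
begin

text \<open>On basis vectors the intertwiner \<open>I\<^sub>n\<close> is a relabelling: the letter in the tensor factor of strand
  \<open>j\<close> records which of the generators \<open>f\<^sub>j\<close>, \<open>g\<^sub>j\<close>, \<open>h\<^sub>j\<close> occur, and a basis tensor goes to the
  reference basis vector with exactly these factors, without sign. Hence \<open>I\<^sub>n\<close> is a linear bijection,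
  and the claim says that conjugation by \<open>I\<^sub>n\<close> carries \<open>\<Phi>\<^sub>n \<circ> hat\<close> to the representation on the tensor
  power. A homomorphism on the braid group is determined by its values on the Artin generators
  (\<open>braid_lift_unique\<close>), so only one crossing has to be compared. The Yang-Baxter equation and
  the invertibility of \<open>S\<close> then hold because they hold for \<open>\<Phi>\<^sub>n\<close>.

  For one crossing, \<open>\<Phi>\<^sub>n(\<sigma>\<^sub>i)\<close> is the composition of three commuting maps, one for each of the colours
  \<open>f\<close>, \<open>g\<close>, \<open>h\<close>, because the exterior algebra is functorial (\<open>exterior_map_compose\<close>) and
  \<open>F \<oplus> G \<oplus> H\<close> changes one colour at a time. Within one colour the generators of index \<open>i\<close> and
  \<open>i + 1\<close> are adjacent in the order of the reference basis; replacing one by the other creates no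
  sign, and only the presence of these two generators matters. Thus each colour acts by the same
  \<open>4 \<times> 4\<close> matrix, namely the exterior algebra of the Burau matrix of a crossing
  (\<open>exterior_map_with_pair\<close>), and \<open>\<Phi>\<^sub>n(\<sigma>\<^sub>i)\<close> acts by the threefold tensor product of that matrix
  (\<open>Phi_sigma_at_crossing\<close>). The blocks of \<open>S\<close> are the entries of the same threefold tensor product
  (\<open>S_bvec_code\<close>). The leftmost tensor factor belongs to strand \<open>n\<close>, so \<open>S\<close> in the factors
  \<open>i\<close>, \<open>i + 1\<close> is a crossing of the strands \<open>n - i\<close>, \<open>n - i + 1\<close>; this reversal is the
  automorphism \<open>hat\<close>.\<close>

section \<open>Linear extension\<close>

interpretation K_space: vector_space "scale :: K \<Rightarrow> 'b fvec \<Rightarrow> 'b fvec"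
  by (rule vector_space_scale)

lemma bvec_in_free_space [simp]: "bvec x \<in> free_space B \<longleftrightarrow> x \<in> B"
  by (simp add: free_space_def bvec_def)

lemma lin_ext_bvec_id: "lin_ext bvec v = v"
  by (rule poly_mapping_eqI)
    (auto simp: lin_ext_def bvec_def lookup_sum lookup_single when_def in_keys_iff
      if_distrib cong: if_cong)

lemma lin_ext_cong:
  "v \<in> free_space B \<Longrightarrow> (\<And>x. x \<in> B \<Longrightarrow> \<phi> x = \<psi> x) \<Longrightarrow> lin_ext \<phi> v = lin_ext \<psi> v"
  by (auto simp: lin_ext_def free_space_def intro!: sum.cong)

lemma free_space_sum: "(\<And>x. x \<in> A \<Longrightarrow> f x \<in> free_space B) \<Longrightarrow> sum f A \<in> free_space B"
  by (induction A rule: infinite_finite_induct) (auto simp: free_space_zero free_space_add)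

lemma lin_ext_in_free_space:
  "v \<in> free_space B \<Longrightarrow> (\<And>x. x \<in> B \<Longrightarrow> \<phi> x \<in> free_space C) \<Longrightarrow> lin_ext \<phi> v \<in> free_space C"
  by (auto simp: lin_ext_def free_space_def[of B] intro!: free_space_sum free_space_scale)

lemma lin_ext_zero [simp]: "lin_ext \<phi> 0 = 0"
  by (simp add: lin_ext_def)

lemma lin_ext_sum: "lin_ext \<phi> (sum f A) = (\<Sum>x\<in>A. lin_ext \<phi> (f x))"
  by (induction A rule: infinite_finite_induct) (auto simp: lin_ext_add)

lemma lin_ext_lin_ext: "lin_ext \<phi> (lin_ext \<psi> v) = lin_ext (\<lambda>x. lin_ext \<phi> (\<psi> x)) v"
  by (simp add: lin_ext_def[of \<psi>] lin_ext_sum lin_ext_scale) (simp add: lin_ext_def)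

lemma lin_ext_add_fun: "lin_ext (\<lambda>x. \<phi> x + \<psi> x) v = lin_ext \<phi> v + lin_ext \<psi> v"
  by (simp add: lin_ext_def K_space.scale_right_distrib sum.distrib)

lemma lin_ext_scale_fun: "lin_ext (\<lambda>x. scale c (\<phi> x)) v = scale c (lin_ext \<phi> v)"
  by (simp add: lin_ext_def K_space.scale_sum_right mult.commute)

lemma lin_ext_zero_fun [simp]: "lin_ext (\<lambda>x. 0) v = 0"
  by (simp add: lin_ext_def)

lemma linear_on_lin_ext: "linear_on V (lin_ext \<phi>)"
  by (simp add: linear_on_def lin_ext_add lin_ext_scale)

lemma linear_on_eq_lin_ext:
  assumes T: "linear_on (free_space B) T" and v: "v \<in> free_space B"
  shows "T v = lin_ext (\<lambda>x. T (bvec x)) v"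
proof -
  have T0: "T 0 = 0"
    using T free_space_zero[of B] unfolding linear_on_def
    by (metis add_cancel_right_right)
  have sum: "T (sum f A) = (\<Sum>x\<in>A. T (f x))" if "\<And>x. x \<in> A \<Longrightarrow> f x \<in> free_space B" for f A
    using that
    by (induction A rule: infinite_finite_induct)
      (use T in \<open>auto simp: T0 linear_on_def free_space_sum\<close>)
  have B: "x \<in> B" if "x \<in> Poly_Mapping.keys v" for x
    using v that by (auto simp: free_space_def)
  have "T v = T (lin_ext bvec v)" by (simp add: lin_ext_bvec_id)
  also have "\<dots> = (\<Sum>x\<in>Poly_Mapping.keys v. T (scale (Poly_Mapping.lookup v x) (bvec x)))"
    unfolding lin_ext_def by (rule sum) (auto simp: B free_space_scale)
  also have "\<dots> = lin_ext (\<lambda>x. T (bvec x)) v"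
    unfolding lin_ext_def using T B by (intro sum.cong) (auto simp: linear_on_def)
  finally show ?thesis .
qed

lemma linear_on_eqI:
  assumes "linear_on (free_space B) T" "linear_on (free_space B) U"
    and "\<And>x. x \<in> B \<Longrightarrow> T (bvec x) = U (bvec x)" and "v \<in> free_space B"
  shows "T v = U v"
  using assms linear_on_eq_lin_ext[of B T v] linear_on_eq_lin_ext[of B U v]
    lin_ext_cong[of v B "\<lambda>x. T (bvec x)" "\<lambda>x. U (bvec x)"] by simp

lemma bij_betw_lin_ext:
  assumes "bij_betw \<phi> B C"
  shows "bij_betw (lin_ext (\<lambda>x. bvec (\<phi> x))) (free_space B) (free_space C)"
proof (rule bij_betw_byWitness)
  let ?\<psi> = "inv_into B \<phi>"
  show "\<forall>v\<in>free_space B. lin_ext (\<lambda>y. bvec (?\<psi> y)) (lin_ext (\<lambda>x. bvec (\<phi> x)) v) = v"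
    using lin_ext_cong[of _ B "\<lambda>x. bvec (?\<psi> (\<phi> x))" bvec] bij_betw_inv_into_left[OF assms]
    by (simp add: lin_ext_lin_ext lin_ext_bvec_id)
  show "\<forall>v\<in>free_space C. lin_ext (\<lambda>x. bvec (\<phi> x)) (lin_ext (\<lambda>y. bvec (?\<psi> y)) v) = v"
    using lin_ext_cong[of _ C "\<lambda>y. bvec (\<phi> (?\<psi> y))" bvec] bij_betw_inv_into_right[OF assms]
    by (simp add: lin_ext_lin_ext lin_ext_bvec_id)
qed (auto intro!: lin_ext_in_free_space[where B = B] lin_ext_in_free_space[where B = C]
    simp: bij_betw_apply[OF assms] bij_betw_apply[OF bij_betw_inv_into[OF assms]])

section \<open>Homomorphisms out of the braid group\<close>

lemma sigma_carrier: "1 \<le> i \<Longrightarrow> i < n \<Longrightarrow> sigma n i \<in> carrier (braid_group n)"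
  by (auto simp: sigma_def braid_words_def intro!: braid_class_carrier)

lemma braid_class_inv_sigma:
  assumes "1 \<le> i" "i < n"
  shows "braid_class n [(i, False)] = inv\<^bsub>braid_group n\<^esub> sigma n i"
proof -
  interpret group "braid_group n" by (rule group_braid_group)
  have w: "[(i, e)] \<in> braid_words n" "[] \<in> braid_words n" for e
    using assms by (auto simp: braid_words_def)
  have w2: "[(i, False), (i, True)] \<in> braid_words n"
    using assms by (auto simp: braid_words_def)
  have "braid_cong n [(i, False), (i, True)] []"
    using braid_cong.cancel[OF assms, of False] by simp
  then have "braid_class n [(i, False)] \<otimes>\<^bsub>braid_group n\<^esub> sigma n i = \<one>\<^bsub>braid_group n\<^esub>"
    by (simp add: sigma_def braid_mult_class w w2 braid_class_eq_iff)
      (simp add: braid_group_def w w2 braid_class_eq_iff)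
  then show ?thesis
    using assms w by (intro inv_equality[symmetric]) (auto simp: sigma_carrier braid_class_carrier)
qed

text \<open>A homomorphism on the braid group is determined by its values on the Artin generators. In
  particular \<open>braid_lift\<close> is well defined as soon as some homomorphism has the prescribed values,
  and no relation between these values has to be verified.\<close>

lemma braid_lift_unique:
  assumes G: "group G" and h: "h \<in> hom (braid_group n) G"
    and g: "\<And>i. 1 \<le> i \<Longrightarrow> i < n \<Longrightarrow> g i = h (sigma n i)"
    and b: "b \<in> carrier (braid_group n)"
  shows "braid_lift G g b = h b"
proof -
  interpret group_hom "braid_group n" G h
    by (simp add: group_hom_def group_hom_axioms_def G h group_braid_group)
  have eval: "word_eval G g w = h (braid_class n w)" if "w \<in> braid_words n" for w
    using that
  proof (induction w)
    case Nil
    have "braid_class n [] = \<one>\<^bsub>braid_group n\<^esub>" by (simp add: braid_group_def)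
    then show ?case by (simp add: word_eval_def)
  next
    case (Cons l w)
    obtain i e where l: "l = (i, e)" by force
    have i: "1 \<le> i" "i < n" and w: "w \<in> braid_words n"
      using Cons.prems by (auto simp: l braid_words_def)
    have li: "[(i, e)] \<in> braid_words n" using i by (auto simp: braid_words_def)
    have "h (braid_class n (l # w)) = h (braid_class n [(i, e)]) \<otimes>\<^bsub>G\<^esub> h (braid_class n w)"
      using braid_mult_class[OF li w] hom_mult[OF braid_class_carrier[OF li] braid_class_carrier[OF w]]
      by (simp add: l)
    also have "h (braid_class n [(i, e)]) = (if e then g i else inv\<^bsub>G\<^esub> (g i))"
      using i by (cases e) (simp_all add: g braid_class_inv_sigma sigma_carrier flip: sigma_def)
    finally show ?case
      using Cons.IH[OF w] by (simp add: l word_eval_def)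
  qed
  obtain w where w: "w \<in> braid_words n" "b = braid_class n w"
    using b by (rule braid_carrierE)
  have cong: "word_eval G g v = h b" if "v \<in> b" for v
  proof -
    have "braid_cong n w v" using that by (simp add: w(2) braid_class_def braid_rel_def)
    then have "v \<in> braid_words n" "braid_class n v = b"
      using braid_cong_words braid_class_eq_iff w by (blast, metis)
    then show ?thesis by (simp add: eval)
  qed
  moreover have "w \<in> b"
    using w by (auto simp: braid_class_def braid_rel_def intro: braid_cong.refl)
  ultimately have "word_eval G g ` b = {h b}" by (auto simp: image_iff)
  then show ?thesis by (simp add: braid_lift_def)
qed

lemma hat_carrier: "b \<in> carrier (braid_group n) \<Longrightarrow> hat n b \<in> carrier (braid_group n)"
  using hat_hom by (rule hom_carrier[THEN subsetD, OF _ imageI])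

text \<open>Both sides are homomorphisms in \<open>b\<close> that fix every Artin generator.\<close>

lemma hat_hat:
  assumes b: "b \<in> carrier (braid_group n)"
  shows "hat n (hat n b) = b"
proof -
  let ?B = "braid_group n"
  have "braid_lift ?B (sigma n) b = (\<lambda>x. x) b"
    using b by (intro braid_lift_unique group_braid_group) (auto simp: hom_def)
  moreover have "braid_lift ?B (sigma n) b = (hat n \<circ> hat n) b"
  proof (rule braid_lift_unique[OF group_braid_group _ _ b])
    show "hat n \<circ> hat n \<in> hom ?B ?B"
      by (rule Group.hom_compose[OF hat_hom hat_hom])
  qed (simp add: hat_sigma)
  ultimately show ?thesis by simp
qed

section \<open>The exterior algebra functor\<close>

text \<open>Vectors indexed by infinite sets have to be excluded: the cardinality that gives the sign in
  \<open>wedge\<close> is meaningless for them, and they have no sorted list of factors.\<close>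

abbreviation fin_ext :: "gen set fvec set" where
  "fin_ext \<equiv> free_space (Collect finite)"

lemma wedge_add_left: "wedge (u + v) w = wedge u w + wedge v w"
  and wedge_scale_left: "wedge (scale c u) w = scale c (wedge u w)"
  and wedge_add_right: "wedge w (u + v) = wedge w u + wedge w v"
  and wedge_scale_right: "wedge w (scale c u) = scale c (wedge w u)"
  by (simp_all add: wedge_def lin_ext_add lin_ext_scale lin_ext_add_fun lin_ext_scale_fun)

lemma wedge_zero [simp]: "wedge 0 u = 0" "wedge u 0 = 0"
  by (simp_all add: wedge_def)

lemma wedge_lin_ext_left: "wedge (lin_ext \<phi> v) u = lin_ext (\<lambda>x. wedge (\<phi> x) u) v"
  by (simp add: wedge_def lin_ext_lin_ext)

lemma wedge_lin_ext_right: "wedge u (lin_ext \<phi> v) = lin_ext (\<lambda>x. wedge u (\<phi> x)) v"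
proof -
  have "wedge u (sum f A) = (\<Sum>x\<in>A. wedge u (f x))" for f and A :: "'a set"
    by (induction A rule: infinite_finite_induct) (auto simp: wedge_add_right)
  then show ?thesis by (simp add: lin_ext_def[of \<phi>] wedge_scale_right) (simp add: lin_ext_def)
qed

lemma wedge_generator_bvec:
  "wedge (bvec {x}) (bvec A) =
     (if x \<in> A then 0 else scale ((- 1) ^ card {b \<in> A. b < x}) (bvec (insert x A)))"
proof -
  have "{(a, b). a = x \<and> b \<in> A \<and> b < a} = Pair x ` {b \<in> A. b < x}" by auto
  then show ?thesis
    by (auto simp: wedge_def card_image inj_on_def)
qed

lemma wedge_in_free_space:
  assumes "\<And>A B. A \<in> P \<Longrightarrow> B \<in> P \<Longrightarrow> A \<union> B \<in> P" "u \<in> free_space P" "v \<in> free_space P"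
  shows "wedge u v \<in> free_space P"
  using assms unfolding wedge_def
  by (intro lin_ext_in_free_space[where B = P]) (auto simp: free_space_zero intro!: free_space_scale)

lemma wedge_in_fin_ext: "u \<in> fin_ext \<Longrightarrow> v \<in> fin_ext \<Longrightarrow> wedge u v \<in> fin_ext"
  by (rule wedge_in_free_space) auto

lemma wedge_deg1_left: "wedge (deg1 v) u = lin_ext (\<lambda>x. wedge (bvec {x}) u) v"
  by (simp only: deg1_def wedge_lin_ext_left)

lemma deg1_in_fin_ext: "deg1 v \<in> fin_ext"
  unfolding deg1_def
  by (rule lin_ext_in_free_space[where B = UNIV]) (simp_all add: free_space_def[of UNIV])

text \<open>Moving the smaller of two generators past the larger one adds or removes exactly one inversion;
  all other inversions are counted equally often on both sides.\<close>

lemma wedge_generators_anticommute: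
  assumes "finite A"
  shows "wedge (bvec {x}) (wedge (bvec {y}) (bvec A)) =
    scale (- 1) (wedge (bvec {y}) (wedge (bvec {x}) (bvec A)))"
proof -
  have lt: "wedge (bvec {x}) (wedge (bvec {y}) (bvec A)) =
      scale (- 1) (wedge (bvec {y}) (wedge (bvec {x}) (bvec A)))" if "x < y" for x y
  proof (cases "x \<in> A \<or> y \<in> A")
    case True
    then show ?thesis by (auto simp: wedge_generator_bvec wedge_scale_right)
  next
    case False
    have "{b. (b = y \<or> b \<in> A) \<and> b < x} = {b \<in> A. b < x}"
      using that by auto
    then have card1: "card {b. (b = y \<or> b \<in> A) \<and> b < x} = card {b \<in> A. b < x}"
      by (rule arg_cong)
    have "{b. (b = x \<or> b \<in> A) \<and> b < y} = insert x {b \<in> A. b < y}"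
      using that by auto
    then have card2: "card {b. (b = x \<or> b \<in> A) \<and> b < y} = Suc (card {b \<in> A. b < y})"
      using False assms by simp
    show ?thesis
      using False that
      by (simp add: wedge_generator_bvec wedge_scale_right insert_commute mult.commute card1 card2)
  qed
  show ?thesis
  proof (cases x y rule: linorder_cases)
    case less
    then show ?thesis by (rule lt)
  next
    case equal
    then show ?thesis by (simp add: wedge_generator_bvec wedge_scale_right)
  next
    case greater
    then show ?thesis by (simp add: lt)
  qed
qed

lemma wedge_deg1_anticommute:
  assumes "u \<in> fin_ext"
  shows "wedge (deg1 v) (wedge (deg1 w) u) = scale (- 1) (wedge (deg1 w) (wedge (deg1 v) u))"
proof -
  have "wedge (bvec {x}) (wedge (bvec {y}) (lin_ext bvec u)) =
      scale (- 1) (wedge (bvec {y}) (wedge (bvec {x}) (lin_ext bvec u)))" for x y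
    unfolding wedge_lin_ext_right lin_ext_scale_fun[symmetric]
    by (rule lin_ext_cong[OF assms]) (rule wedge_generators_anticommute, simp)
  then have gens: "wedge (bvec {x}) (wedge (bvec {y}) u) =
      scale (- 1) (wedge (bvec {y}) (wedge (bvec {x}) u))" for x y
    unfolding lin_ext_bvec_id .
  have "lin_ext (\<lambda>x. wedge (bvec {x}) (wedge (bvec {y}) u)) v =
      lin_ext (\<lambda>x. scale (- 1) (wedge (bvec {y}) (wedge (bvec {x}) u))) v" for y
    by (rule arg_cong[where f = "\<lambda>f. lin_ext f v"]) (rule ext, rule gens)
  then have left: "wedge (deg1 v) (wedge (bvec {y}) u) =
      scale (- 1) (wedge (bvec {y}) (wedge (deg1 v) u))" for y
    unfolding wedge_deg1_left wedge_lin_ext_right lin_ext_scale_fun .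
  have "lin_ext (\<lambda>y. wedge (deg1 v) (wedge (bvec {y}) u)) w =
      lin_ext (\<lambda>y. scale (- 1) (wedge (bvec {y}) (wedge (deg1 v) u))) w"
    by (rule arg_cong[where f = "\<lambda>f. lin_ext f w"]) (rule ext, rule left)
  then show ?thesis
    unfolding wedge_deg1_left[of w] wedge_lin_ext_right lin_ext_scale_fun .
qed

lemma two_neq_zero_K: "(2 :: K) \<noteq> 0"
proof
  assume "(2 :: K) = 0"
  then have "(of_nat 2 :: K) = 0"
    by (rule HOL.trans[OF of_nat_numeral])
  then have "Fraction_Field.Fract (of_nat 2) (1 :: complex poly) = Fraction_Field.Fract 0 1"
    by (rule HOL.trans[OF Fraction_Field.Fract_of_nat_eq HOL.trans[OF _ Zero_fract_def]])
  then have "(of_nat 2 :: complex poly) * 1 = 0 * 1"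
    by (rule eq_fract(1)[THEN iffD1, rotated 2]) (rule one_neq_zero)+
  then have "(of_nat 2 :: complex poly) = 0"
    unfolding mult_1_right mult_zero_left .
  then show False by (metis of_nat_eq_0_iff zero_neq_numeral)
qed

text \<open>Anticommutativity gives \<open>w = - w\<close>, and the characteristic of the base field is not two.\<close>

lemma wedge_deg1_self:
  assumes "u \<in> fin_ext"
  shows "wedge (deg1 v) (wedge (deg1 v) u) = 0"
proof -
  define w where "w = wedge (deg1 v) (wedge (deg1 v) u)"
  have "w = scale (- 1) w"
    unfolding w_def by (rule wedge_deg1_anticommute[OF assms])
  then have "scale (1 - (- 1)) w = 0"
    unfolding K_space.scale_left_diff_distrib K_space.scale_one right_minus_eq .
  moreover have "(1 :: K) - (- 1) \<noteq> 0"
    by (subst diff_minus_eq_add, subst one_add_one) (rule two_neq_zero_K)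
  ultimately have "w = 0" unfolding K_space.scale_eq_0_iff by blast
  then show ?thesis unfolding w_def .
qed

lemma exterior_map_empty [simp]: "exterior_map T (bvec {}) = bvec {}"
  by (simp add: exterior_map_def wedge_list_def)

lemma exterior_map_add: "exterior_map T (u + v) = exterior_map T u + exterior_map T v"
  and exterior_map_scale: "exterior_map T (scale c u) = scale c (exterior_map T u)"
  and exterior_map_zero [simp]: "exterior_map T 0 = 0"
  and exterior_map_lin_ext: "exterior_map T (lin_ext \<phi> w) = lin_ext (\<lambda>x. exterior_map T (\<phi> x)) w"
  unfolding exterior_map_def
  by (rule lin_ext_add lin_ext_scale lin_ext_zero lin_ext_lin_ext)+

lemma exterior_map_insert_min:
  assumes "finite A" "\<And>a. a \<in> A \<Longrightarrow> x < a"
  shows "exterior_map T (bvec (insert x A)) =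
    wedge (deg1 (T (bvec x))) (exterior_map T (bvec A))"
proof -
  have "x \<notin> A" using assms(2) by blast
  then have "sorted_list_of_set (insert x A) = x # sorted_list_of_set A"
    using assms by (simp add: insort_is_Cons less_imp_le)
  then show ?thesis by (simp add: exterior_map_def wedge_list_def)
qed

lemma exterior_map_bvec_in_fin_ext: "finite A \<Longrightarrow> exterior_map T (bvec A) \<in> fin_ext"
  by (induction A rule: finite_linorder_min_induct)
    (auto simp: exterior_map_insert_min wedge_in_fin_ext deg1_in_fin_ext)

text \<open>\<open>exterior_map T\<close> is defined through the increasing order of the factors, so multiplicativity is
  clear only when \<open>x\<close> precedes all of \<open>A\<close>. In general the least element \<open>y\<close> of \<open>A\<close> is split off:
  if \<open>y < x\<close> then \<open>x\<close> and \<open>y\<close> anticommute, and so do their images, and if \<open>y = x\<close> both sides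
  vanish.\<close>

lemma exterior_map_wedge_generator:
  assumes "finite A"
  shows "exterior_map T (wedge (bvec {x}) (bvec A)) =
    wedge (deg1 (T (bvec x))) (exterior_map T (bvec A))"
  using assms
proof (induction A rule: finite_linorder_min_induct)
  case empty
  then show ?case
    using exterior_map_insert_min[of "{}" x T] by (simp add: wedge_generator_bvec)
next
  case (insert y A)
  have fin: "exterior_map T (bvec A) \<in> fin_ext"
    using insert by (simp add: exterior_map_bvec_in_fin_ext)
  have yA: "bvec (insert y A) = wedge (bvec {y}) (bvec A)"
  proof -
    have "{b \<in> A. b < y} = {}" "y \<notin> A" using insert by auto
    then show ?thesis by (simp only: wedge_generator_bvec) simp
  qed
  note step = exterior_map_insert_min[of A y T]
  show ?case
  proof (cases x y rule: linorder_cases)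
    case less
    then have "{b \<in> insert y A. b < x} = {}" "x \<notin> insert y A" using insert by auto
    then have "wedge (bvec {x}) (bvec (insert y A)) = bvec (insert x (insert y A))"
      by (simp only: wedge_generator_bvec) simp
    moreover have "exterior_map T (bvec (insert x (insert y A))) =
        wedge (deg1 (T (bvec x))) (exterior_map T (bvec (insert y A)))"
      using less insert.hyps by (intro exterior_map_insert_min) auto
    ultimately show ?thesis by simp
  next
    case equal
    have "exterior_map T (bvec (insert y A)) = wedge (deg1 (T (bvec y))) (exterior_map T (bvec A))"
      using insert.hyps by (intro step) auto
    then show ?thesis
      using equal by (simp add: wedge_generator_bvec wedge_deg1_self[OF fin])
  next
    case greater
    have y: "exterior_map T (wedge (bvec {y}) (wedge (bvec {x}) (bvec A))) =
        wedge (deg1 (T (bvec y))) (exterior_map T (wedge (bvec {x}) (bvec A)))"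
    proof (cases "x \<in> A")
      case False
      have "{b \<in> insert x A. b < y} = {}" "y \<notin> insert x A" using insert greater by auto
      then have "wedge (bvec {y}) (bvec (insert x A)) = bvec (insert y (insert x A))"
        by (simp only: wedge_generator_bvec) simp
      moreover have "exterior_map T (bvec (insert y (insert x A))) =
          wedge (deg1 (T (bvec y))) (exterior_map T (bvec (insert x A)))"
        using insert greater by (intro exterior_map_insert_min) auto
      ultimately show ?thesis
        using False
        by (simp add: wedge_generator_bvec[of x] wedge_scale_right exterior_map_scale)
    qed (simp add: wedge_generator_bvec)
    have "exterior_map T (wedge (bvec {x}) (bvec (insert y A))) =
        scale (- 1) (wedge (deg1 (T (bvec y))) (wedge (deg1 (T (bvec x))) (exterior_map T (bvec A))))"
      using insert.IH insert.hyps
      by (simp only: yA wedge_generators_anticommute[of A x y] exterior_map_scale y)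
    also have "\<dots> = wedge (deg1 (T (bvec x))) (wedge (deg1 (T (bvec y))) (exterior_map T (bvec A)))"
      by (rule wedge_deg1_anticommute[OF fin, symmetric])
    also have "\<dots> = wedge (deg1 (T (bvec x))) (exterior_map T (bvec (insert y A)))"
      using insert.hyps by (subst step) auto
    finally show ?thesis .
  qed
qed

text \<open>The linear extension of \<open>exterior_map_wedge_generator\<close>: multiplicativity for a left factor of
  degree one, which is all that functoriality needs.\<close>

lemma exterior_map_wedge_deg1:
  assumes u: "u \<in> fin_ext"
  shows "exterior_map (lin_ext \<phi>) (wedge (deg1 v) u) =
    wedge (deg1 (lin_ext \<phi> v)) (exterior_map (lin_ext \<phi>) u)"
proof -
  have *: "exterior_map (lin_ext \<phi>) (wedge (bvec {x}) u) =
      wedge (deg1 (\<phi> x)) (exterior_map (lin_ext \<phi>) u)" for x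
  proof -
    have "exterior_map (lin_ext \<phi>) (wedge (bvec {x}) (lin_ext bvec u)) =
        wedge (deg1 (\<phi> x)) (exterior_map (lin_ext \<phi>) (lin_ext bvec u))"
      by (simp only: wedge_lin_ext_right exterior_map_lin_ext)
        (rule lin_ext_cong[OF u], simp add: exterior_map_wedge_generator)
    then show ?thesis by (simp only: lin_ext_bvec_id)
  qed
  show ?thesis
    unfolding wedge_deg1_left[of v] exterior_map_lin_ext *
    by (simp only: deg1_def lin_ext_lin_ext wedge_lin_ext_left)
qed

text \<open>Functoriality of the exterior algebra, with \<open>V\<close> the composition of \<open>lin_ext \<phi>\<close> and \<open>U\<close> on the
  generators involved. One factor is split off at a time.\<close>

lemma exterior_map_compose:
  assumes "finite A" "\<And>x. x \<in> A \<Longrightarrow> V (bvec x) = lin_ext \<phi> (U (bvec x))"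
  shows "exterior_map (lin_ext \<phi>) (exterior_map U (bvec A)) = exterior_map V (bvec A)"
  using assms
proof (induction A rule: finite_linorder_min_induct)
  case (insert x A)
  have "exterior_map (lin_ext \<phi>) (exterior_map U (bvec (insert x A))) =
      wedge (deg1 (lin_ext \<phi> (U (bvec x)))) (exterior_map (lin_ext \<phi>) (exterior_map U (bvec A)))"
    using insert.hyps exterior_map_bvec_in_fin_ext[of A U]
    by (simp only: exterior_map_insert_min exterior_map_wedge_deg1)
  also have "\<dots> = exterior_map V (bvec (insert x A))"
    using insert by (simp only: exterior_map_insert_min insertI1 insertI2)
  finally show ?case .
qed simp

lemma exterior_map_fixes:
  assumes "finite A" "\<And>x. x \<in> A \<Longrightarrow> T (bvec x) = bvec x"
  shows "exterior_map T (bvec A) = bvec A"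
proof -
  have "map (\<lambda>x. deg1 (T (bvec x))) (sorted_list_of_set A) =
      map (\<lambda>x. bvec {x}) (sorted_list_of_set A)"
    using assms by (auto simp: deg1_def)
  then show ?thesis
    unfolding exterior_map_def lin_ext_bvec by (simp only: bvec_eq_wedge_list[OF assms(1)])
qed

section \<open>The Burau representation and its exterior algebra\<close>

lemma rt_neq_zero: "rt \<noteq> 0"
proof
  assume "rt = 0"
  then have "Fraction_Field.Fract [:0, 1 :: complex:] 1 = Fraction_Field.Fract 0 1"
    unfolding rt_def Zero_fract_def .
  then have "[:0, 1 :: complex:] * 1 = 0 * 1"
    by (rule eq_fract(1)[THEN iffD1, rotated 2]) (rule one_neq_zero)+
  then show False by simp
qed

lemma GL_mult_apply: "v \<in> V \<Longrightarrow> (T \<otimes>\<^bsub>GL V\<^esub> U) v = T (U v)"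
  by (simp add: GL_def compose_def)

lemma GL_one_apply: "v \<in> V \<Longrightarrow> \<one>\<^bsub>GL V\<^esub> v = v"
  by (simp add: GL_def)

lemma GL_maps: "T \<in> carrier (GL V) \<Longrightarrow> v \<in> V \<Longrightarrow> T v \<in> V"
  by (auto simp: GL_def dest: bij_betwE)

lemma GL_linear: "T \<in> carrier (GL V) \<Longrightarrow> linear_on V T"
  by (simp add: GL_def)

lemma GL_extensional: "T \<in> carrier (GL V) \<Longrightarrow> T \<in> extensional V"
  by (simp add: GL_def)

lemma GL_eqI:
  assumes "T \<in> carrier (GL (free_space B))" "U \<in> carrier (GL (free_space B))"
    and "\<And>x. x \<in> B \<Longrightarrow> T (bvec x) = U (bvec x)"
  shows "T = U"
proof (rule extensionalityI)
  show "T \<in> extensional (free_space B)" "U \<in> extensional (free_space B)"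
    using assms by (simp_all add: GL_extensional)
  show "T v = U v" if "v \<in> free_space B" for v
    by (rule linear_on_eqI[OF GL_linear[OF assms(1)] GL_linear[OF assms(2)] assms(3) that])
qed

lemma restrict_in_GL:
  assumes "\<And>x. x \<in> B \<Longrightarrow> \<phi> x \<in> free_space B" "\<And>x. x \<in> B \<Longrightarrow> \<psi> x \<in> free_space B"
    and "\<And>x. x \<in> B \<Longrightarrow> lin_ext \<psi> (\<phi> x) = bvec x" "\<And>x. x \<in> B \<Longrightarrow> lin_ext \<phi> (\<psi> x) = bvec x"
  shows "restrict (lin_ext \<phi>) (free_space B) \<in> carrier (GL (free_space B))"
proof -
  have "bij_betw (lin_ext \<phi>) (free_space B) (free_space B)"
  proof (rule bij_betw_byWitness)
    show "\<forall>v\<in>free_space B. lin_ext \<psi> (lin_ext \<phi> v) = v"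
      using lin_ext_cong[of _ B "\<lambda>x. lin_ext \<psi> (\<phi> x)" bvec] assms(3)
      by (simp add: lin_ext_lin_ext lin_ext_bvec_id)
    show "\<forall>v\<in>free_space B. lin_ext \<phi> (lin_ext \<psi> v) = v"
      using lin_ext_cong[of _ B "\<lambda>x. lin_ext \<phi> (\<psi> x)" bvec] assms(4)
      by (simp add: lin_ext_lin_ext lin_ext_bvec_id)
  qed (auto intro!: lin_ext_in_free_space[where B = B] assms)
  then have "bij_betw (restrict (lin_ext \<phi>) (free_space B)) (free_space B) (free_space B)"
    by (subst bij_betw_cong[where g = "lin_ext \<phi>"]) auto
  then show ?thesis
    by (auto simp: GL_def linear_on_def lin_ext_add lin_ext_scale free_space_add free_space_scale)
qed

lemma burau_gen_bvec:
  "burau_gen c i (bvec x) =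
     (if x = c i then scale (1 / rt) (bvec (c (i + 1)))
      else if x = c (i + 1) then scale (1 / rt) (bvec (c i)) + scale (1 - 1 / t0) (bvec (c (i + 1)))
      else bvec x)"
  by (simp add: burau_gen_def)

lemma burau_gen_add: "burau_gen c i (u + v) = burau_gen c i u + burau_gen c i v"
  and burau_gen_scale: "burau_gen c i (scale a u) = scale a (burau_gen c i u)"
  by (simp_all add: burau_gen_def lin_ext_add lin_ext_scale)

lemma burau_gen_in_Wn:
  assumes "1 \<le> i" "i < n" "v \<in> Wn c n"
  shows "burau_gen c i v \<in> Wn c n"
  using assms unfolding Wn_def burau_gen_def
  by (intro lin_ext_in_free_space[where B = "c ` {1..n}"])
    (auto intro!: free_space_add free_space_scale)

text \<open>The inverse is written out; it comes from inverting the \<open>2 \<times> 2\<close> matrix of a crossing.\<close>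

lemma burau_gen_in_GL:
  assumes c: "inj c" and i: "1 \<le> i" "i < n"
  shows "restrict (burau_gen c i) (Wn c n) \<in> carrier (GL (Wn c n))"
proof -
  have neq: "c (Suc i) \<noteq> c i" using c by (auto dest: injD)
  have coeff: "(1 - t0) / rt + (1 - 1 / t0) * rt = 0" "(1 - t0) / rt + rt * (1 - 1 / t0) = 0"
    using rt_neq_zero by (simp_all add: t0_def power2_eq_square field_simps)
  have cancel: "u + (scale a w + scale b w) = u" "scale a w + scale b w = 0" "scale a w + (scale b w + u) = u"
     if "a + b = 0" for u w :: "gen fvec" and a b
    using that by (simp_all add: add.assoc[symmetric] flip: K_space.scale_left_distrib)
  show ?thesis
    unfolding burau_gen_def Wn_def
  proof (rule restrict_in_GL[where \<psi> = "\<lambda>x. 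
     if x = c i then scale (1 - t0) (bvec (c i)) + scale rt (bvec (c (i + 1)))
     else if x = c (i + 1) then scale rt (bvec (c i))
     else bvec x"])
  qed (use i neq rt_neq_zero in \<open>auto intro!: free_space_add free_space_scale
       simp: lin_ext_add lin_ext_scale K_space.scale_right_distrib add.assoc coeff cancel\<close>)
qed

lemma burau_gen_far:
  assumes c: "inj c" and ij: "i + 1 < j"
  shows "burau_gen c i (burau_gen c j (bvec x)) = burau_gen c j (burau_gen c i (bvec x))"
proof -
  have "c i \<noteq> c j" "c (Suc i) \<noteq> c j" "c i \<noteq> c (Suc j)" "c (Suc i) \<noteq> c (Suc j)"
    using ij c by (auto dest!: injD)
  then show ?thesis
    by (auto simp: burau_gen_bvec burau_gen_add burau_gen_scale)
qed

text \<open>In terms of \<open>s = 1 / rt\<close> and \<open>d = 1 - 1 / t0\<close> the only relation needed is \<open>d = s\<^sup>2 d + d\<^sup>2\<close>.\<close>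

lemma burau_gen_braid:
  assumes c: "inj c"
  shows "burau_gen c i (burau_gen c (i + 1) (burau_gen c i (bvec x))) =
    burau_gen c (i + 1) (burau_gen c i (burau_gen c (i + 1) (bvec x)))"
proof -
  have neq: "c i \<noteq> c (Suc i)" "c i \<noteq> c (Suc (Suc i))" "c (Suc i) \<noteq> c (Suc (Suc i))"
    "c (Suc i) \<noteq> c i" "c (Suc (Suc i)) \<noteq> c i" "c (Suc (Suc i)) \<noteq> c (Suc i)"
    using c by (auto dest!: injD)
  define s d where "s = 1 / rt" and "d = 1 - 1 / t0"
  have d: "scale d u = scale (s * (s * d)) u + scale (d * d) u" for u :: "gen fvec"
    unfolding K_space.scale_left_distrib[symmetric] s_def d_def t0_def
    by (rule arg_cong[where f = "\<lambda>a. scale a u"]) (simp add: algebra_simps power2_eq_square)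
  show ?thesis
    unfolding burau_gen_bvec burau_gen_add burau_gen_scale
    by (simp add: neq burau_gen_bvec burau_gen_add burau_gen_scale
        K_space.scale_right_distrib add.assoc mult.commute flip: s_def d_def)
      (use d in \<open>auto simp: add_ac mult_ac\<close>)
qed

lemma
  assumes c: "inj c"
  shows burau_hom: "burau c n \<in> hom (braid_group n) (GL (Wn c n))"
    and burau_sigma: "\<And>i. 1 \<le> i \<Longrightarrow> i < n \<Longrightarrow> burau c n (sigma n i) = restrict (burau_gen c i) (Wn c n)"
proof -
  let ?V = "Wn c n" and ?T = "\<lambda>i. restrict (burau_gen c i) (Wn c n)"
  have V: "?V = free_space (c ` {1..n})" by (simp add: Wn_def)
  interpret group "GL ?V" unfolding V by (rule group_GL)
  have T: "?T i \<in> carrier (GL ?V)" if "1 \<le> i" "i < n" for i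
    using that by (rule burau_gen_in_GL[OF c])
  have bvec: "bvec x \<in> ?V" if "x \<in> c ` {1..n}" for x
    using that by (simp add: V)
  note eqI = GL_eqI[of _ "c ` {1..n}", folded V]
  note * = GL_mult_apply bvec burau_gen_in_Wn
  have far: "?T i \<otimes>\<^bsub>GL ?V\<^esub> ?T j = ?T j \<otimes>\<^bsub>GL ?V\<^esub> ?T i"
    if "1 \<le> i" "i + 1 < j" "j < n" for i j
  proof (rule eqI)
    show "(?T i \<otimes>\<^bsub>GL ?V\<^esub> ?T j) (bvec x) = (?T j \<otimes>\<^bsub>GL ?V\<^esub> ?T i) (bvec x)" if "x \<in> c ` {1..n}" for x
      using that \<open>1 \<le> i\<close> \<open>i + 1 < j\<close> \<open>j < n\<close> burau_gen_far[OF c, of i j x] by (simp add: *)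
  qed (use that in \<open>auto intro!: m_closed T\<close>)
  have braid: "?T i \<otimes>\<^bsub>GL ?V\<^esub> ?T (i + 1) \<otimes>\<^bsub>GL ?V\<^esub> ?T i =
      ?T (i + 1) \<otimes>\<^bsub>GL ?V\<^esub> ?T i \<otimes>\<^bsub>GL ?V\<^esub> ?T (i + 1)"
    if "1 \<le> i" "i + 1 < n" for i
  proof (rule eqI)
    show "(?T i \<otimes>\<^bsub>GL ?V\<^esub> ?T (i + 1) \<otimes>\<^bsub>GL ?V\<^esub> ?T i) (bvec x) =
        (?T (i + 1) \<otimes>\<^bsub>GL ?V\<^esub> ?T i \<otimes>\<^bsub>GL ?V\<^esub> ?T (i + 1)) (bvec x)" if "x \<in> c ` {1..n}" for x
      using that \<open>1 \<le> i\<close> \<open>i + 1 < n\<close> burau_gen_braid[OF c, of i x] by (simp add: *)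
  qed (use that in \<open>auto intro!: m_closed T\<close>)
  note rels = is_group T far braid
  show "burau c n \<in> hom (braid_group n) (GL ?V)"
    unfolding burau_def by (rule braid_lift_hom[of _ n ?T, OF rels])
  show "burau c n (sigma n i) = ?T i" if "1 \<le> i" "i < n" for i
    unfolding burau_def by (rule braid_lift_sigma[of _ n ?T, OF rels that])
qed

definition gens :: "nat \<Rightarrow> gen set" where
  "gens n = Fg ` {1..n} \<union> Gg ` {1..n} \<union> Hg ` {1..n}"

lemma finite_gens: "finite (gens n)"
  by (simp add: gens_def)

lemma exterior_eq: "exterior n = free_space (Pow (gens n))"
  by (simp add: exterior_def gens_def Pow_def)

lemma inj_colours: "inj Fg" "inj Gg" "inj Hg"
  by (simp_all add: inj_def)

definition burau_sum :: "nat \<Rightarrow> (nat \<times> bool) list set \<Rightarrow> gen fvec \<Rightarrow> gen fvec" where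
  "burau_sum n b = direct_sum (burau Fg n b) (burau Gg n b) (burau Hg n b)"

lemma Phi_eq: "Phi n b = restrict (exterior_map (burau_sum n b)) (exterior n)"
  by (simp add: Phi_def burau_sum_def)

lemma burau_carrier:
  assumes "inj c" "b \<in> carrier (braid_group n)"
  shows "burau c n b \<in> carrier (GL (Wn c n))"
  using burau_hom[OF assms(1)] assms(2) by (rule hom_carrier[THEN subsetD, OF _ imageI])

lemma burau_sum_on_colour:
  assumes b: "b \<in> carrier (braid_group n)" and c: "c \<in> {Fg, Gg, Hg}" and v: "v \<in> Wn c n"
  shows "burau_sum n b v = burau c n b v"
proof -
  have inj: "inj c" using c inj_colours by auto
  have "burau c n b v = lin_ext (\<lambda>x. burau c n b (bvec x)) v"
    using v GL_linear[OF burau_carrier[OF inj b]] unfolding Wn_def by (intro linear_on_eq_lin_ext)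
  also have "\<dots> = burau_sum n b v"
    using v c unfolding burau_sum_def direct_sum_def Wn_def
    by (intro lin_ext_cong[where B = "c ` {1..n}"]) auto
  finally show ?thesis by simp
qed

text \<open>A generator lies in the summand of its colour, so that statements about \<open>burau_sum\<close> reduce to
  statements about the Burau representation.\<close>

lemma gens_cases:
  assumes "x \<in> gens n"
  obtains c where "c \<in> {Fg, Gg, Hg}" "inj c" "bvec x \<in> Wn c n" "Wn c n \<subseteq> free_space (gens n)"
proof -
  have "\<exists>c\<in>{Fg, Gg, Hg}. x \<in> c ` {1..n} \<and> c ` {1..n} \<subseteq> gens n"
    using assms unfolding gens_def by auto
  then obtain c where c: "c \<in> {Fg, Gg, Hg}" "x \<in> c ` {1..n}" "c ` {1..n} \<subseteq> gens n"
    by blast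
  moreover have "inj c" using c inj_colours by auto
  moreover have "Wn c n \<subseteq> free_space (gens n)"
    using c(3) by (auto simp: Wn_def free_space_def)
  ultimately show ?thesis using that by (auto simp: Wn_def)
qed

lemma burau_sum_in_free_space:
  assumes b: "b \<in> carrier (braid_group n)" and x: "x \<in> gens n"
  shows "burau_sum n b (bvec x) \<in> free_space (gens n)"
proof -
  obtain c where c: "c \<in> {Fg, Gg, Hg}" "inj c" "bvec x \<in> Wn c n" "Wn c n \<subseteq> free_space (gens n)"
    using x by (rule gens_cases)
  show ?thesis
    using c GL_maps[OF burau_carrier[OF c(2) b] c(3)] by (auto simp: burau_sum_on_colour[OF b])
qed

lemma burau_sum_mult:
  assumes a: "a \<in> carrier (braid_group n)" and b: "b \<in> carrier (braid_group n)" and x: "x \<in> gens n"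
  shows "burau_sum n (a \<otimes>\<^bsub>braid_group n\<^esub> b) (bvec x) = burau_sum n a (burau_sum n b (bvec x))"
proof -
  interpret group "braid_group n" by (rule group_braid_group)
  obtain c where c: "c \<in> {Fg, Gg, Hg}" "inj c" "bvec x \<in> Wn c n"
    using x by (rule gens_cases)
  show ?thesis
    using hom_mult[OF burau_hom[OF c(2)] a b] c(3) GL_maps[OF burau_carrier[OF c(2) b] c(3)]
    by (simp add: burau_sum_on_colour[OF _ c(1)] a b GL_mult_apply)
qed

lemma burau_sum_one:
  assumes x: "x \<in> gens n"
  shows "burau_sum n \<one>\<^bsub>braid_group n\<^esub> (bvec x) = bvec x"
proof -
  obtain c where c: "c \<in> {Fg, Gg, Hg}" "inj c" "bvec x \<in> Wn c n"
    using x by (rule gens_cases)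
  interpret group "braid_group n" by (rule group_braid_group)
  have "group (GL (Wn c n))" unfolding Wn_def by (rule group_GL)
  then have "burau c n \<one>\<^bsub>braid_group n\<^esub> = \<one>\<^bsub>GL (Wn c n)\<^esub>"
    using burau_hom[OF c(2)] is_group by (intro hom_one)
  then show ?thesis
    using c(3) by (simp add: burau_sum_on_colour[OF _ c(1)] GL_one_apply)
qed

lemma exterior_map_in_exterior:
  assumes T: "\<And>x. x \<in> gens n \<Longrightarrow> T (bvec x) \<in> free_space (gens n)" and A: "A \<subseteq> gens n"
  shows "exterior_map T (bvec A) \<in> exterior n"
proof -
  have "finite A" using A finite_gens finite_subset by blast
  then show ?thesis
    using A
  proof (induction A rule: finite_linorder_min_induct)
    case (insert x A)
    have "deg1 (T (bvec x)) \<in> exterior n"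
      using T[of x] insert.prems unfolding deg1_def exterior_eq
      by (intro lin_ext_in_free_space[where B = "gens n"]) auto
    then show ?case
      using insert wedge_in_free_space[of "Pow (gens n)"]
      by (simp add: exterior_map_insert_min exterior_eq)
  qed (simp add: exterior_eq)
qed

lemma Phi_bvec: "A \<subseteq> gens n \<Longrightarrow> Phi n b (bvec A) = exterior_map (burau_sum n b) (bvec A)"
  by (simp add: Phi_eq exterior_eq)

text \<open>Functoriality turns the Burau representations into the representation \<open>\<Phi>\<^sub>n\<close>.\<close>

lemma Phi_hom: "Phi n \<in> hom (braid_group n) (GL (exterior n))"
proof -
  let ?B = "braid_group n" and ?V = "exterior n"
  interpret group ?B by (rule group_braid_group)
  have lin: "exterior_map (burau_sum n b) = lin_ext (\<lambda>A. exterior_map (burau_sum n b) (bvec A))" for b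
    by (simp add: exterior_map_def)
  have lin': "burau_sum n b = lin_ext (\<lambda>x. burau_sum n b (bvec x))" for b
    by (simp add: burau_sum_def direct_sum_def)
  have maps: "exterior_map (burau_sum n b) (bvec A) \<in> ?V" if "b \<in> carrier ?B" "A \<in> Pow (gens n)" for b A
    using that by (intro exterior_map_in_exterior burau_sum_in_free_space) auto
  have mult: "exterior_map (burau_sum n a) (exterior_map (burau_sum n b) (bvec A)) =
      exterior_map (burau_sum n (a \<otimes>\<^bsub>?B\<^esub> b)) (bvec A)"
    if "a \<in> carrier ?B" "b \<in> carrier ?B" "A \<in> Pow (gens n)" for a b A
  proof -
    have "finite A" using that finite_gens finite_subset by blast
    then show ?thesis
      using that exterior_map_compose[of A "burau_sum n (a \<otimes>\<^bsub>?B\<^esub> b)" "\<lambda>x. burau_sum n a (bvec x)"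
          "burau_sum n b", folded lin'] burau_sum_mult
      by blast
  qed
  have one: "exterior_map (burau_sum n \<one>\<^bsub>?B\<^esub>) (bvec A) = bvec A" if "A \<in> Pow (gens n)" for A
  proof -
    have "finite A" using that finite_gens finite_subset by blast
    then show ?thesis
      using that burau_sum_one by (intro exterior_map_fixes) auto
  qed
  \<comment> \<open>The inverse of \<open>\<Phi>\<^sub>n(b)\<close> comes from the inverse braid.\<close>
  have car: "Phi n b \<in> carrier (GL ?V)" if b: "b \<in> carrier ?B" for b
    unfolding Phi_eq exterior_eq
    by (subst lin, rule restrict_in_GL[where \<psi> = "\<lambda>A. exterior_map (burau_sum n (inv\<^bsub>?B\<^esub> b)) (bvec A)"])
      (simp_all add: b maps[unfolded exterior_eq] mult one flip: lin)
  show ?thesis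
  proof (rule homI[OF car])
    fix a b assume ab: "a \<in> carrier ?B" "b \<in> carrier ?B"
    interpret GL: group "GL ?V" unfolding exterior_eq by (rule group_GL)
    show "Phi n (a \<otimes>\<^bsub>?B\<^esub> b) = Phi n a \<otimes>\<^bsub>GL ?V\<^esub> Phi n b"
    proof (rule GL_eqI[of _ "Pow (gens n)", folded exterior_eq])
      show "Phi n (a \<otimes>\<^bsub>?B\<^esub> b) (bvec A) = (Phi n a \<otimes>\<^bsub>GL ?V\<^esub> Phi n b) (bvec A)"
        if "A \<in> Pow (gens n)" for A
        using that ab maps[of b A] mult[of a b A]
        by (simp add: GL_mult_apply exterior_eq Phi_eq)
    qed (use ab car in auto)
  qed
qed

section \<open>One crossing\<close>

text \<open>The exterior algebra of the Burau matrix of a crossing. The arguments tell whether the generators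
  of index \<open>i + 1\<close> and \<open>i\<close>, in this order, are factors of a basis vector; the result lists the
  coefficients of its image under \<open>\<sigma>\<^sub>i\<close>. The coefficient for two factors is the determinant.\<close>

definition crossing_terms :: "bool \<Rightarrow> bool \<Rightarrow> (K \<times> bool \<times> bool) list" where
  "crossing_terms u l =
    (if u then if l then [(- (1 / t0), True, True)]
               else [(1 / rt, False, True), (1 - 1 / t0, True, False)]
     else if l then [(1 / rt, True, False)] else [(1, False, False)])"

text \<open>The index \<open>k\<close> for which \<open>e\<^sub>k\<close> stands for the presence of \<open>f\<close>, \<open>g\<close>, \<open>h\<close>.\<close>

definition code :: "bool \<Rightarrow> bool \<Rightarrow> bool \<Rightarrow> nat" where
  "code f g h =
    (if f then if g then if h then 8 else 5 else if h then 6 else 2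
     else if g then if h then 7 else 3 else if h then 4 else 1)"

fun position :: "'a \<Rightarrow> 'a list \<Rightarrow> nat" where
  "position q [] = 0"
| "position q (x # xs) = (if x = q then 0 else Suc (position q xs))"

lemma nth_eq_iff_position:
  "distinct xs \<Longrightarrow> q \<in> set xs \<Longrightarrow> j < length xs \<Longrightarrow> xs ! j = q \<longleftrightarrow> j = position q xs"
proof (induction xs arbitrary: j)
  case (Cons x xs)
  then show ?case by (cases j) auto
qed simp

lemma position_less_length: "q \<in> set xs \<Longrightarrow> position q xs < length xs"
  by (induction xs) auto

text \<open>The double sum in the definition of \<open>S\<close> is non-zero only in the column of \<open>q\<close>; as a sum over a list
  this column can be evaluated by rewriting.\<close>

lemma block_column:
  fixes M :: "K list list" and bs :: "'b list"
  assumes "distinct bs" "length M = length bs"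
  shows "(\<Sum>j<length bs. \<Sum>i<length bs.
        if bs ! j = q then scale (c * M ! i ! j) (bvec (bs ! i)) else 0) =
      (if q \<in> set bs then \<Sum>(x, r) \<leftarrow> zip bs M. scale (c * r ! position q bs) (bvec x) else 0)"
proof (cases "q \<in> set bs")
  case True
  let ?p = "position q bs"
  have "(\<Sum>j<length bs. \<Sum>i<length bs.
        if bs ! j = q then scale (c * M ! i ! j) (bvec (bs ! i)) else 0) =
      (\<Sum>j<length bs. if j = ?p then \<Sum>i<length bs. scale (c * M ! i ! ?p) (bvec (bs ! i)) else 0)"
    using nth_eq_iff_position[OF assms(1) True] by (intro sum.cong) auto
  also have "\<dots> = (\<Sum>i<length bs. scale (c * M ! i ! ?p) (bvec (bs ! i)))"
    using position_less_length[OF True] by simp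
  also have "\<dots> = (\<Sum>(x, r) \<leftarrow> zip bs M. scale (c * r ! ?p) (bvec x))"
    using assms(2) by (simp add: sum_list_sum_nth lessThan_atLeast0 case_prod_beta)
  finally show ?thesis using True by simp
next
  case False
  then show ?thesis by (auto simp: in_set_conv_nth intro!: sum.neutral)
qed

lemma S_bvec:
  "S (bvec q) = (\<Sum>(c, M, bs) \<leftarrow> S_blocks.
     if q \<in> set bs then \<Sum>(x, r) \<leftarrow> zip bs M. scale (c * r ! position q bs) (bvec x) else 0)"
proof -
  have "\<forall>(c, M, bs) \<in> set S_blocks. distinct bs \<and> length M = length bs"
    by (simp add: S_blocks_def matA_def matB_def matC_def diag_mat_list_def)
  then show ?thesis
    unfolding S_def lin_ext_bvec
    by (intro arg_cong[where f = sum_list] map_cong refl) (auto simp only: block_column split: prod.splits)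
qed

text \<open>\<open>S\<close> is the threefold tensor product of the matrix of a crossing: in each block the products of
  \<open>1 / rt\<close>, \<open>1 - 1 / t0\<close> and \<open>- (1 / t0)\<close> have been collected into a scalar times a matrix in \<open>Y\<close>.
  The 64 columns are compared one by one.\<close>

lemma S_bvec_code:
  "S (bvec [code f' g' h', code f g h]) =
    (\<Sum>(a, f1, f0) \<leftarrow> crossing_terms f' f. \<Sum>(b, g1, g0) \<leftarrow> crossing_terms g' g. \<Sum>(c, h1, h0) \<leftarrow> crossing_terms h' h.
       scale (a * b * c) (bvec [code f1 g1 h1, code f0 g0 h0]))"
proof -
  \<comment> \<open>Since \<open>1 - 1 / t0 = s * Y\<close>, every coefficient on either side becomes a signed monomial
    in \<open>s\<close> and \<open>Y\<close>, and the two sides agree up to reordering.\<close>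
  define s where "s = 1 / rt"
  have s: "1 - s * s = s * Y" "1 / t0 = s * s" "1 / t0 ^ 2 = s * (s * (s * s))"
    "1 / t0 ^ 3 = s * (s * (s * (s * (s * s))))" "1 / rt ^ 3 = s * (s * s)" "1 / rt = s"
    using rt_neq_zero
    by (simp_all add: s_def Y_def t0_def field_simps power2_eq_square power3_eq_cube)
  have Y: "Y ^ 2 = Y * Y" "Y ^ 3 = Y * (Y * Y)"
    by (simp_all add: power2_eq_square power3_eq_cube)
  show ?thesis
    unfolding S_bvec S_blocks_def diag_mat_list_def matA_def matB_def matC_def crossing_terms_def code_def s Y
    by (cases f'; cases f; cases g'; cases g; cases h'; cases h) (simp_all add: ac_simps)
qed

lemma colour_adjacent:
  assumes "c \<in> {Fg, Gg, Hg}"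
  shows "z < c (Suc i) \<longleftrightarrow> z < c i \<or> z = c i"
  using assms by (cases z) (auto simp: less_gen_def)

text \<open>Moving \<open>c i\<close> or \<open>c (Suc i)\<close> to its place among the elements of \<open>Z\<close> produces the same sign \<open>e\<close>,
  because the two are adjacent. Pulling a factor to the front, applying \<open>burau_gen\<close> to it and
  putting the image back therefore gives \<open>e * e = 1\<close>. When both are present, the term that
  keeps \<open>c (Suc i)\<close> in place is a wedge product with a repeated factor, and the remaining one has the
  transposed order, whence the minus sign.\<close>

lemma exterior_map_burau_gen:
  assumes c: "c \<in> {Fg, Gg, Hg}" and Z: "finite Z" "c i \<notin> Z" "c (Suc i) \<notin> Z"
  defines "E \<equiv> exterior_map (burau_gen c i)"
  shows "E (bvec Z) = bvec Z"
    and "E (bvec (insert (c i) Z)) = scale (1 / rt) (bvec (insert (c (Suc i)) Z))"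
    and "E (bvec (insert (c (Suc i)) Z)) =
      scale (1 / rt) (bvec (insert (c i) Z)) + scale (1 - 1 / t0) (bvec (insert (c (Suc i)) Z))"
    and "E (bvec (insert (c i) (insert (c (Suc i)) Z))) =
      scale (- (1 / t0)) (bvec (insert (c i) (insert (c (Suc i)) Z)))"
proof -
  let ?x = "c i" and ?y = "c (Suc i)"
  have neq: "?x \<noteq> ?y" "?y \<noteq> ?x" using c by auto
  have fixes_Z: "E (bvec Z) = bvec Z"
    unfolding E_def using Z by (intro exterior_map_fixes) (auto simp: burau_gen_bvec)
  define e :: K where "e = (- 1) ^ card {b \<in> Z. b < ?x}"
  have ee: "e * e = 1" by (simp add: e_def flip: power_add mult_2)
  have y_Z: "{b \<in> Z. b < ?y} = {b \<in> Z. b < ?x}"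
    using Z by (auto simp: colour_adjacent[OF c])
  have x_yZ: "{b \<in> insert ?y Z. b < ?x} = {b \<in> Z. b < ?x}"
    using colour_adjacent[OF c, of ?y i] by auto
  have y_xZ: "{b \<in> insert ?x Z. b < ?y} = insert ?x {b \<in> Z. b < ?x}"
    using Z by (auto simp: colour_adjacent[OF c])
  have "card {b \<in> insert ?x Z. b < ?y} = Suc (card {b \<in> Z. b < ?x})"
    unfolding y_xZ using Z by simp
  then have wedge: "wedge (bvec {?x}) (bvec Z) = scale e (bvec (insert ?x Z))"
      "wedge (bvec {?y}) (bvec Z) = scale e (bvec (insert ?y Z))"
      "wedge (bvec {?x}) (bvec (insert ?y Z)) = scale e (bvec (insert ?x (insert ?y Z)))"
      "wedge (bvec {?y}) (bvec (insert ?x Z)) = scale (- e) (bvec (insert ?x (insert ?y Z)))"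
      "wedge (bvec {?y}) (bvec (insert ?y Z)) = 0"
    unfolding wedge_generator_bvec x_yZ y_Z using Z neq by (simp_all add: e_def insert_commute)
  have E_wedge: "E (wedge (bvec {x}) (bvec A)) = wedge (deg1 (burau_gen c i (bvec x))) (E (bvec A))"
    if "finite A" for x A
    unfolding E_def using that by (rule exterior_map_wedge_generator)
  have deg1: "deg1 (burau_gen c i (bvec ?x)) = scale (1 / rt) (bvec {?y})"
      "deg1 (burau_gen c i (bvec ?y)) = scale (1 / rt) (bvec {?x}) + scale (1 - 1 / t0) (bvec {?y})"
    using neq by (simp_all add: burau_gen_bvec deg1_def lin_ext_add lin_ext_scale)
  note E_scale = exterior_map_scale[of "burau_gen c i", folded E_def]
  note bilinear = wedge_add_left wedge_scale_left wedge_add_right wedge_scale_right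
    K_space.scale_right_distrib
  show "E (bvec Z) = bvec Z" by (rule fixes_Z)
  have scale_e: "scale (e * (a * e)) u = scale a u" for a and u :: "gen set fvec"
    using ee by (simp add: mult.left_commute)
  have finite: "finite Z" "finite (insert ?y Z)" using Z by auto
  have x: "E (bvec (insert ?x Z)) = scale e (E (wedge (bvec {?x}) (bvec Z)))"
    by (simp add: wedge E_scale ee)
  show "E (bvec (insert ?x Z)) = scale (1 / rt) (bvec (insert ?y Z))"
    unfolding x E_wedge[OF finite(1)]
    by (simp only: fixes_Z deg1 bilinear wedge K_space.scale_scale scale_e)
  have y: "E (bvec (insert ?y Z)) = scale e (E (wedge (bvec {?y}) (bvec Z)))"
    by (simp add: wedge E_scale ee)
  show Ey: "E (bvec (insert ?y Z)) =
      scale (1 / rt) (bvec (insert ?x Z)) + scale (1 - 1 / t0) (bvec (insert ?y Z))"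
    unfolding y E_wedge[OF finite(1)]
    by (simp only: fixes_Z deg1 bilinear wedge K_space.scale_scale scale_e)
  have xy: "E (bvec (insert ?x (insert ?y Z))) = scale e (E (wedge (bvec {?x}) (bvec (insert ?y Z))))"
    by (simp add: wedge E_scale ee)
  have t0: "1 / rt * (1 / rt) = 1 / t0" by (simp add: t0_def power2_eq_square)
  show "E (bvec (insert ?x (insert ?y Z))) = scale (- (1 / t0)) (bvec (insert ?x (insert ?y Z)))"
    unfolding xy E_wedge[OF finite(2)] t0[symmetric]
    by (simp add: Ey deg1 bilinear wedge ee mult.left_commute)
qed

text \<open>For \<open>Z\<close> without \<open>c i\<close> and \<open>c (Suc i)\<close> these are the four sets of factors on which one colour acts
  at a crossing; the flags are ordered as in \<open>crossing_terms\<close>.\<close>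

definition with_pair :: "(nat \<Rightarrow> gen) \<Rightarrow> nat \<Rightarrow> bool \<Rightarrow> bool \<Rightarrow> gen set \<Rightarrow> gen set" where
  "with_pair c i u l Z = Z \<union> {x. u \<and> x = c (Suc i) \<or> l \<and> x = c i}"

lemma with_pair_commute:
  "with_pair c i u l (with_pair d j u' l' Z) = with_pair d j u' l' (with_pair c i u l Z)"
  by (auto simp: with_pair_def)

lemma exterior_map_with_pair:
  assumes c: "c \<in> {Fg, Gg, Hg}" and Z: "finite Z" "c i \<notin> Z" "c (Suc i) \<notin> Z"
  shows "exterior_map (burau_gen c i) (bvec (with_pair c i u l Z)) =
    (\<Sum>(k, u', l') \<leftarrow> crossing_terms u l. scale k (bvec (with_pair c i u' l' Z)))"
proof -
  have "with_pair c i False False Z = Z"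
    "with_pair c i False True Z = insert (c i) Z"
    "with_pair c i True False Z = insert (c (Suc i)) Z"
    "with_pair c i True True Z = insert (c i) (insert (c (Suc i)) Z)"
    by (auto simp: with_pair_def)
  then show ?thesis
    using exterior_map_burau_gen[OF assms] by (cases u; cases l) (simp_all add: crossing_terms_def)
qed

lemma exterior_map_sum_list:
  "exterior_map T (\<Sum>x\<leftarrow>xs. f x) = (\<Sum>x\<leftarrow>xs. exterior_map T (f x))"
  by (induction xs) (simp_all add: exterior_map_add)

lemma lin_ext_sum_list: "lin_ext \<phi> (\<Sum>x\<leftarrow>xs. f x) = (\<Sum>x\<leftarrow>xs. lin_ext \<phi> (f x))"
  by (induction xs) (simp_all add: lin_ext_add)

lemma scale_sum_list: "scale k (\<Sum>x\<leftarrow>xs. f x) = (\<Sum>x\<leftarrow>xs. scale k (f x))"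
  by (induction xs) (simp_all add: K_space.scale_right_distrib)

text \<open>On the generators, \<open>F \<oplus> G \<oplus> H\<close> is the composition of the three maps that each change a
  single colour.\<close>

lemma Phi_sigma_bvec:
  assumes i: "1 \<le> i" "i < n" and A: "A \<subseteq> gens n"
  shows "Phi n (sigma n i) (bvec A) =
    exterior_map (burau_gen Hg i) (exterior_map (burau_gen Gg i) (exterior_map (burau_gen Fg i) (bvec A)))"
proof -
  have finA: "finite A" using A finite_gens finite_subset by blast
  have burau_gen: "burau_gen c i = lin_ext (\<lambda>x. burau_gen c i (bvec x))" for c
    by (simp add: burau_gen_def)
  have sum: "burau_sum n (sigma n i) (bvec (c j)) = burau_gen c i (bvec (c j))"
    if "c \<in> {Fg, Gg, Hg}" "j \<in> {1..n}" for c j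
  proof -
    have "inj c" using that inj_colours by auto
    moreover have "bvec (c j) \<in> Wn c n" using that by (auto simp: Wn_def)
    ultimately show ?thesis
      using that i by (simp add: burau_sum_on_colour[OF sigma_carrier] burau_sigma)
  qed
  have gen: "burau_sum n (sigma n i) (bvec x) =
      burau_gen Hg i (burau_gen Gg i (burau_gen Fg i (bvec x)))" if "x \<in> gens n" for x
  proof -
    from that consider j where "x = Fg j" "j \<in> {1..n}" | j where "x = Gg j" "j \<in> {1..n}"
      | j where "x = Hg j" "j \<in> {1..n}"
      unfolding gens_def by blast
    then show ?thesis
      by cases (simp_all add: sum burau_gen_bvec burau_gen_add burau_gen_scale)
  qed
  have "exterior_map (burau_sum n (sigma n i)) (bvec A) =
      exterior_map (burau_gen Hg i) (exterior_map (\<lambda>v. burau_gen Gg i (burau_gen Fg i v)) (bvec A))"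
    by (rule exterior_map_compose[OF finA, of "burau_sum n (sigma n i)" "\<lambda>x. burau_gen Hg i (bvec x)"
        "\<lambda>v. burau_gen Gg i (burau_gen Fg i v)", folded burau_gen, symmetric]) (use A gen in blast)
  also have "exterior_map (\<lambda>v. burau_gen Gg i (burau_gen Fg i v)) (bvec A) =
      exterior_map (burau_gen Gg i) (exterior_map (burau_gen Fg i) (bvec A))"
    by (rule exterior_map_compose[OF finA, of "\<lambda>v. burau_gen Gg i (burau_gen Fg i v)"
        "\<lambda>x. burau_gen Gg i (bvec x)" "burau_gen Fg i", folded burau_gen, symmetric]) (rule HOL.refl)
  finally show ?thesis using A by (simp add: Phi_bvec)
qed

text \<open>\<open>Z\<close> holds the factors away from the crossing; the flags of index \<open>i + 1\<close> come first, as the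
  tensor factor of the higher strand stands further left.\<close>

definition at_crossing ::
    "nat \<Rightarrow> gen set \<Rightarrow> bool \<Rightarrow> bool \<Rightarrow> bool \<Rightarrow> bool \<Rightarrow> bool \<Rightarrow> bool \<Rightarrow> gen set" where
  "at_crossing i Z f' g' h' f g h =
     with_pair Fg i f' f (with_pair Gg i g' g (with_pair Hg i h' h Z))"

lemma Phi_sigma_at_crossing:
  assumes i: "1 \<le> i" "i < n" and sub: "at_crossing i Z f' g' h' f g h \<subseteq> gens n"
    and Z: "\<And>c. c \<in> {Fg, Gg, Hg} \<Longrightarrow> c i \<notin> Z" "\<And>c. c \<in> {Fg, Gg, Hg} \<Longrightarrow> c (Suc i) \<notin> Z"
  shows "Phi n (sigma n i) (bvec (at_crossing i Z f' g' h' f g h)) =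
    (\<Sum>(a, f1, f0) \<leftarrow> crossing_terms f' f. \<Sum>(b, g1, g0) \<leftarrow> crossing_terms g' g. \<Sum>(c, h1, h0) \<leftarrow> crossing_terms h' h.
       scale (a * b * c) (bvec (at_crossing i Z f1 g1 h1 f0 g0 h0)))"
proof -
  have fin: "finite Z"
    using sub finite_gens[of n] by (auto simp: at_crossing_def with_pair_def intro: finite_subset)
  have fin': "finite (with_pair c i u l X)" if "finite X" for c u l X
    using that by (auto simp: with_pair_def)
  have mem: "c j \<in> with_pair d i u l X \<longleftrightarrow> c j \<in> X"
    if "c \<in> {Fg, Gg, Hg}" "d \<in> {Fg, Gg, Hg}" "c \<noteq> d" for c d j u l X
    using that by (auto simp: with_pair_def)
  have neq: "Fg \<noteq> Gg" "Fg \<noteq> Hg" "Gg \<noteq> Fg" "Gg \<noteq> Hg" "Hg \<noteq> Fg" "Hg \<noteq> Gg"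
    by (auto dest: fun_cong[where x = 0])
  have F: "exterior_map (burau_gen Fg i) (bvec (at_crossing i Z f' g' h' f g h)) =
      (\<Sum>(a, f1, f0) \<leftarrow> crossing_terms f' f. scale a (bvec (at_crossing i Z f1 g' h' f0 g h)))" for f' g' h' f g h
    unfolding at_crossing_def
    by (rule exterior_map_with_pair) (simp_all add: fin fin' mem neq Z)
  have G: "exterior_map (burau_gen Gg i) (bvec (at_crossing i Z f' g' h' f g h)) =
      (\<Sum>(b, g1, g0) \<leftarrow> crossing_terms g' g. scale b (bvec (at_crossing i Z f' g1 h' f g0 h)))" for f' g' h' f g h
    unfolding at_crossing_def with_pair_commute[of Fg _ _ _ Gg]
    by (rule exterior_map_with_pair) (simp_all add: fin fin' mem neq Z)
  have H: "exterior_map (burau_gen Hg i) (bvec (at_crossing i Z f' g' h' f g h)) =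
      (\<Sum>(c, h1, h0) \<leftarrow> crossing_terms h' h. scale c (bvec (at_crossing i Z f' g' h1 f g h0)))" for f' g' h' f g h
    unfolding at_crossing_def with_pair_commute[of Gg _ _ _ Hg] with_pair_commute[of Fg _ _ _ Hg]
    by (rule exterior_map_with_pair) (simp_all add: fin fin' mem neq Z)
  show ?thesis
    unfolding Phi_sigma_bvec[OF i sub]
    by (simp add: F G H exterior_map_sum_list exterior_map_scale scale_sum_list case_prod_unfold mult.assoc)
qed

section \<open>The intertwiner on basis vectors\<close>

lemma code_range: "code f g h \<in> {1..8}"
  by (simp add: code_def)

lemma code_cases:
  assumes "k \<in> {1..8}"
  obtains f g h where "k = code f g h"
proof -
  have "k = 1 \<or> k = 2 \<or> k = 3 \<or> k = 4 \<or> k = 5 \<or> k = 6 \<or> k = 7 \<or> k = 8"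
    using assms by auto
  then have "\<exists>f g h. k = code f g h"
    by (auto simp: code_def split: if_splits)
  then show ?thesis using that by blast
qed

lemma wedge_bvec:
  "A \<inter> B = {} \<Longrightarrow>
    wedge (bvec A) (bvec B) = scale ((- 1) ^ card {(a, b) \<in> A \<times> B. b < a}) (bvec (A \<union> B))"
  by (simp add: wedge_def)

lemma reord_scale_bvec:
  assumes "a \<noteq> 0"
  shows "reord (scale a (bvec A)) = bvec A"
proof -
  have "Poly_Mapping.keys (scale a (bvec A)) = {A}"
    using assms by (auto simp: in_keys_iff bvec_def lookup_single when_def split: if_splits)
  then show ?thesis by (simp add: reord_def)
qed

definition factors :: "nat \<Rightarrow> nat \<Rightarrow> gen set" where
  "factors k j = {x. x = Fg j \<and> k \<in> {2, 5, 6, 8} \<or> x = Gg j \<and> k \<in> {3, 5, 7, 8} \<or>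
     x = Hg j \<and> k \<in> {4, 6, 7, 8}}"

lemma factors_code: "factors (code f g h) j = {x. f \<and> x = Fg j \<or> g \<and> x = Gg j \<or> h \<and> x = Hg j}"
  by (auto simp: factors_def code_def)

lemma bvec_set_sorted:
  assumes "sorted xs" "distinct xs"
  shows "wedge_list (map (\<lambda>x. bvec {x}) xs) = bvec (set xs)"
  using bvec_eq_wedge_list[of "set xs"] sorted_list_of_set.idem_if_sorted_distinct[OF assms] by simp

lemma new_factors_eq:
  assumes "k \<in> {1..8}"
  shows "new_factors k n = bvec (factors k n)"
proof -
  obtain f g h where k: "k = code f g h" using assms by (rule code_cases)
  let ?L = "[[], [Fg n], [Gg n], [Hg n], [Fg n, Gg n], [Fg n, Hg n], [Gg n, Hg n],
    [Fg n, Gg n, Hg n]] ! (k - 1)"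
  have "sorted ?L \<and> distinct ?L \<and> set ?L = factors k n"
    unfolding k factors_code
    by (cases f; cases g; cases h) (auto simp: code_def less_eq_gen_def less_gen_def)
  then show ?thesis
    unfolding new_factors_def using bvec_set_sorted[of ?L] by simp
qed

text \<open>The offset \<open>m\<close> counts the tensor factors further to the right, which occupy the strands
  \<open>1, \<dots>, m\<close>; it makes \<open>factor_set\<close> compatible with concatenation.\<close>

fun factor_set :: "nat \<Rightarrow> nat list \<Rightarrow> gen set" where
  "factor_set m [] = {}"
| "factor_set m (k # l) = factor_set m l \<union> factors k (m + Suc (length l))"

lemma factor_set_append:
  "factor_set m (l @ l') = factor_set (m + length l') l \<union> factor_set m l'"
  by (induction l) (auto simp: ac_simps)

fun strand :: "gen \<Rightarrow> nat" where
  "strand (Fg j) = j"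
| "strand (Gg j) = j"
| "strand (Hg j) = j"

lemma strand_factors: "x \<in> factors k j \<Longrightarrow> strand x = j"
  by (auto simp: factors_def)

lemma strand_factor_set: "x \<in> factor_set m l \<Longrightarrow> m < strand x \<and> strand x \<le> m + length l"
  by (induction l) (auto dest: strand_factors)

lemma gens_eq_strand: "gens n = {x. 1 \<le> strand x \<and> strand x \<le> n}"
proof (rule Set.set_eqI)
  show "x \<in> gens n \<longleftrightarrow> x \<in> {x. 1 \<le> strand x \<and> strand x \<le> n}" for x
    by (cases x) (auto simp: gens_def)
qed

lemma factor_set_subset_gens: "factor_set 0 l \<subseteq> gens (length l)"
  using strand_factor_set by (force simp: gens_eq_strand)

text \<open>The generators of the new strand are disjoint from the earlier ones, so that the wedge product is
  a basis vector up to sign. \<open>reord\<close> discards the sign; for the indices 1 and 4, where it is not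
  applied, the sign is \<open>+\<close> because nothing is added or the new \<open>h\<close> exceeds all earlier generators.\<close>

lemma I_basis_eq:
  "l \<noteq> [] \<Longrightarrow> set l \<subseteq> {1..8} \<Longrightarrow> I_basis l = bvec (factor_set 0 l)"
proof (induction l rule: I_basis.induct)
  case (2 k)
  then show ?case by (simp add: new_factors_eq)
next
  case (3 k j x)
  let ?A = "factor_set 0 (j # x)" and ?B = "factors k (Suc (length (j # x)))"
  have IH: "I_basis (j # x) = bvec ?A"
    using "3.prems" by (intro "3.IH") auto
  have disj: "?A \<inter> ?B = {}"
    using strand_factor_set[of _ 0 "j # x"] strand_factors by fastforce
  define e :: K where "e = (- 1) ^ card {(a, b) \<in> ?A \<times> ?B. b < a}"
  have wedge: "wedge (I_basis (j # x)) (new_factors k (length (k # j # x))) = scale e (bvec (?A \<union> ?B))"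
  proof -
    have new: "new_factors k (length (k # j # x)) = bvec ?B"
      using "3.prems" new_factors_eq[of k "length (k # j # x)"] by simp
    show ?thesis unfolding IH new e_def using disj by (rule wedge_bvec)
  qed
  have "e \<noteq> 0" by (simp add: e_def)
  then have reord: "reord (scale e (bvec (?A \<union> ?B))) = bvec (?A \<union> ?B)"
    by (rule reord_scale_bvec)
  have last: "scale e (bvec (?A \<union> ?B)) = bvec (?A \<union> ?B)" if "k = 1 \<or> k = 4"
  proof -
    have "{(a, b) \<in> ?A \<times> ?B. b < a} = {}"
    proof -
      have False if "a \<in> ?A" "b \<in> ?B" "b < a" for a b
        using \<open>k = 1 \<or> k = 4\<close> strand_factor_set[OF that(1)] that(2,3)
        by (cases a) (auto simp: factors_def less_gen_def)
      then show ?thesis by blast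
    qed
    then show ?thesis unfolding e_def by (simp only: card.empty power_0 K_space.scale_one)
  qed
  show ?case
    unfolding I_basis.simps Let_def wedge using reord last by simp
qed simp

definition indices :: "nat \<Rightarrow> nat list set" where
  "indices n = {l. length l = n \<and> set l \<subseteq> {1..8}}"

lemma tensor_power_eq: "tensor_power n = free_space (indices n)"
  by (simp add: tensor_power_def indices_def)

lemma I_map_eq:
  assumes "n \<ge> 1"
  shows "I_map n = restrict (lin_ext (\<lambda>l. bvec (factor_set 0 l))) (tensor_power n)"
proof -
  have "lin_ext I_basis v = lin_ext (\<lambda>l. bvec (factor_set 0 l)) v" if "v \<in> tensor_power n" for v
    using assms that unfolding tensor_power_eq
    by (intro lin_ext_cong[where B = "indices n"] I_basis_eq) (auto simp: indices_def)
  then show ?thesis by (auto simp: I_map_def restrict_def)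
qed

lemma factor_set_cong_tail:
  assumes "factor_set 0 (k # l) = factor_set 0 (k' # l')" "length l = length l'"
  shows "factor_set 0 l = factor_set 0 l'" "factors k (Suc (length l)) = factors k' (Suc (length l))"
proof -
  have low: "{x \<in> factor_set 0 (k # l). strand x \<le> length l} = factor_set 0 l"
    and high: "{x \<in> factor_set 0 (k # l). length l < strand x} = factors k (Suc (length l))" for k l
    using strand_factor_set[of _ 0 l] strand_factors[of _ k "Suc (length l)"] by fastforce+
  show "factor_set 0 l = factor_set 0 l'" "factors k (Suc (length l)) = factors k' (Suc (length l))"
    using low[of k l] low[of k' l'] high[of k l] high[of k' l'] assms by metis+
qed

lemma factors_inj:
  assumes "k \<in> {1..8}" "k' \<in> {1..8}" "factors k j = factors k' j"
  shows "k = k'"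
proof -
  obtain f g h f' g' h' where k: "k = code f g h" "k' = code f' g' h'"
    using assms code_cases by metis
  have "Fg j \<in> factors k j \<longleftrightarrow> Fg j \<in> factors k' j" "Gg j \<in> factors k j \<longleftrightarrow> Gg j \<in> factors k' j"
    "Hg j \<in> factors k j \<longleftrightarrow> Hg j \<in> factors k' j"
    using assms(3) by auto
  then show ?thesis by (simp add: k factors_code)
qed

text \<open>The letter on the top strand and the rest of the list can be recovered from the factors of index \<open>n\<close>
  and from the others.\<close>

lemma bij_factor_set: "bij_betw (factor_set 0) (indices n) (Pow (gens n))"
proof -
  have inj: "l = l'"
    if "length l = length l'" "set l \<subseteq> {1..8}" "set l' \<subseteq> {1..8}" "factor_set 0 l = factor_set 0 l'"
    for l l' :: "nat list"
    using that
  proof (induction l l' rule: list_induct2)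
    case (Cons k l k' l')
    then show ?case
      using factor_set_cong_tail[OF Cons.prems(3) Cons.hyps] factors_inj[of k k'] by simp
  qed simp
  have surj: "\<exists>l\<in>indices n. factor_set 0 l = A" if "A \<subseteq> gens n" for A
    using that
  proof (induction n arbitrary: A)
    case 0
    then show ?case by (simp add: gens_def indices_def)
  next
    case (Suc n)
    let ?k = "code (Fg (Suc n) \<in> A) (Gg (Suc n) \<in> A) (Hg (Suc n) \<in> A)"
    obtain l where l: "l \<in> indices n" "factor_set 0 l = A \<inter> gens n"
      using Suc.IH[of "A \<inter> gens n"] by auto
    have "A = (A \<inter> gens n) \<union> factors ?k (Suc n)"
    proof (rule Set.set_eqI)
      show "x \<in> A \<longleftrightarrow> x \<in> (A \<inter> gens n) \<union> factors ?k (Suc n)" for x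
        using Suc.prems unfolding gens_eq_strand factors_code
        by (cases x) (auto simp: le_Suc_eq)
    qed
    then have "?k # l \<in> indices (Suc n)" "factor_set 0 (?k # l) = A"
      using l code_range by (auto simp: indices_def)
    then show ?case by blast
  qed
  show ?thesis
  proof (rule bij_betw_imageI)
    show "inj_on (factor_set 0) (indices n)"
      using inj by (auto simp: inj_on_def indices_def)
    have "factor_set 0 l \<subseteq> gens n" if "l \<in> indices n" for l
      using factor_set_subset_gens[of l] that by (simp add: indices_def)
    then show "factor_set 0 ` indices n = Pow (gens n)"
      using surj by blast
  qed
qed

lemma I_map_bij: "n \<ge> 1 \<Longrightarrow> bij_betw (I_map n) (tensor_power n) (exterior n)"
  unfolding I_map_eq tensor_power_eq exterior_eq
  by (subst bij_betw_cong[where g = "lin_ext (\<lambda>l. bvec (factor_set 0 l))"])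
    (simp_all add: bij_betw_lin_ext[OF bij_factor_set])

lemma I_map_bvec: "n \<ge> 1 \<Longrightarrow> l \<in> indices n \<Longrightarrow> I_map n (bvec l) = bvec (factor_set 0 l)"
  by (simp add: I_map_eq tensor_power_eq)

lemma I_map_linear: "n \<ge> 1 \<Longrightarrow> linear_on (tensor_power n) (I_map n)"
  by (simp add: I_map_eq tensor_power_eq linear_on_def lin_ext_add lin_ext_scale free_space_add free_space_scale)

text \<open>Two neighbouring tensor factors are two neighbouring strands, in the opposite order.\<close>

lemma factor_set_crossing:
  assumes "i = Suc (length r)"
  shows "factor_set 0 (l @ [code f' g' h', code f g h] @ r) =
    at_crossing i (factor_set (Suc i) l \<union> factor_set 0 r) f' g' h' f g h"
  unfolding assms
  by (auto simp: factor_set_append factors_code at_crossing_def with_pair_def)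

section \<open>The intertwining relation\<close>

text \<open>Transport of automorphisms along a linear bijection.\<close>

lemma conjugation_hom:
  fixes I :: "'b fvec \<Rightarrow> 'c fvec" and B :: "'b set" and C :: "'c set"
  defines "V \<equiv> free_space B" and "X \<equiv> free_space C"
  assumes bij: "bij_betw I V X" and lin: "linear_on V I"
  shows "(\<lambda>T. restrict (\<lambda>v. inv_into V I (T (I v))) V) \<in> hom (GL X) (GL V)"
proof -
  let ?J = "inv_into V I"
  have I: "I v \<in> X" if "v \<in> V" for v using bij that by (rule bij_betw_apply)
  have J: "?J y \<in> V" if "y \<in> X" for y using bij_betw_inv_into[OF bij] that by (rule bij_betw_apply)
  have IJ: "I (?J y) = y" if "y \<in> X" for y using bij that by (rule bij_betw_inv_into_right)
  have JI: "?J (I v) = v" if "v \<in> V" for v using bij that by (rule bij_betw_inv_into_left)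
  have V: "u \<in> V \<Longrightarrow> v \<in> V \<Longrightarrow> u + v \<in> V" "u \<in> V \<Longrightarrow> scale a u \<in> V" for u v a
    by (simp_all add: V_def free_space_add free_space_scale)
  have J_add: "?J (y + z) = ?J y + ?J z" if "y \<in> X" "z \<in> X" for y z
    using JI[of "?J y + ?J z"] lin that by (simp add: linear_on_def J IJ V)
  have J_scale: "?J (scale a y) = scale a (?J y)" if "y \<in> X" for a y
    using JI[of "scale a (?J y)"] lin that by (simp add: linear_on_def J IJ V)
  show ?thesis
  proof (rule homI)
    fix T assume T: "T \<in> carrier (GL X)"
    have TX: "T y \<in> X" if "y \<in> X" for y using T that by (rule GL_maps)
    have "bij_betw T X X" using T by (simp add: GL_def)
    then have "bij_betw (?J \<circ> (T \<circ> I)) V V"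
      using bij bij_betw_inv_into[OF bij] by (intro bij_betw_trans)
    then have "bij_betw (restrict (\<lambda>v. ?J (T (I v))) V) V V"
      by (subst bij_betw_cong[where g = "?J \<circ> (T \<circ> I)"]) auto
    moreover have "linear_on V (restrict (\<lambda>v. ?J (T (I v))) V)"
      using lin GL_linear[OF T] by (simp add: linear_on_def V I TX J_add J_scale)
    ultimately show "restrict (\<lambda>v. ?J (T (I v))) V \<in> carrier (GL V)"
      by (simp add: GL_def)
  next
    fix T U assume T: "T \<in> carrier (GL X)" and U: "U \<in> carrier (GL X)"
    have UX: "U y \<in> X" if "y \<in> X" for y using U that by (rule GL_maps)
    show "restrict (\<lambda>v. ?J ((T \<otimes>\<^bsub>GL X\<^esub> U) (I v))) V =
        restrict (\<lambda>v. ?J (T (I v))) V \<otimes>\<^bsub>GL V\<^esub> restrict (\<lambda>v. ?J (U (I v))) V"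
      by (auto simp: GL_def compose_def fun_eq_iff I J IJ UX)
  qed
qed

text \<open>The operator by which \<open>\<sigma>\<^sub>i\<close> acts on the tensor power.\<close>

definition S_at :: "nat \<Rightarrow> nat list fvec \<Rightarrow> nat list fvec" where
  "S_at i = tensor_map (i - 1) id (tensor_map 2 S id)"

lemma S_at_bvec:
  assumes "i = Suc (length l)"
  shows "S_at i (bvec (l @ [p, q] @ r)) = lin_ext (\<lambda>k. bvec (l @ k @ r)) (S (bvec [p, q]))"
  by (simp add: assms S_at_def tensor_map_def tensor_def lin_ext_lin_ext)

lemma free_space_sum_list:
  "(\<And>x. x \<in> set xs \<Longrightarrow> f x \<in> free_space B) \<Longrightarrow> (\<Sum>x\<leftarrow>xs. f x) \<in> free_space B"
  by (induction xs) (auto simp: free_space_zero free_space_add)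

lemma index_split:
  assumes "l \<in> indices n" "1 \<le> i" "i < n"
  obtains p f' g' h' f g h r where "l = p @ [code f' g' h', code f g h] @ r"
    "i = Suc (length p)" "n - i = Suc (length r)" "set p \<subseteq> {1..8}" "set r \<subseteq> {1..8}"
proof -
  have len: "length l = n" and set: "set l \<subseteq> {1..8}" using assms(1) by (simp_all add: indices_def)
  have l: "l = take (i - 1) l @ [l ! (i - 1), l ! i] @ drop (Suc i) l"
    using assms(2,3) len Cons_nth_drop_Suc[of "i - 1" l] Cons_nth_drop_Suc[of i l]
      append_take_drop_id[of "i - 1" l] by simp
  have nth: "l ! (i - 1) \<in> {1..8}" "l ! i \<in> {1..8}"
    using assms(2,3) len by (auto simp only: intro!: subsetD[OF set] nth_mem)
  obtain f' g' h' where 1: "l ! (i - 1) = code f' g' h'" using nth(1) by (rule code_cases)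
  obtain f g h where 2: "l ! i = code f g h" using nth(2) by (rule code_cases)
  show ?thesis
  proof (rule that)
    show "l = take (i - 1) l @ [code f' g' h', code f g h] @ drop (Suc i) l"
      using l unfolding 1 2 .
  qed (use assms(2,3) len set set_take_subset[of "i - 1" l] set_drop_subset[of "Suc i" l] in auto)
qed

text \<open>The comparison for one crossing. By \<open>S_bvec_code\<close> and \<open>Phi_sigma_at_crossing\<close> both sides are the
  same sum over the terms of the three colours.\<close>

lemma S_at_intertwined:
  assumes i: "1 \<le> i" "i < n" and l: "l \<in> indices n"
  shows "S_at i (bvec l) \<in> tensor_power n"
    and "I_map n (S_at i (bvec l)) = Phi n (sigma n (n - i)) (I_map n (bvec l))"
proof -
  have n: "n \<ge> 1" using i by simp
  obtain p f' g' h' f g h r where l_eq: "l = p @ [code f' g' h', code f g h] @ r"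
    and len: "i = Suc (length p)" "n - i = Suc (length r)"
    and sets: "set p \<subseteq> {1..8}" "set r \<subseteq> {1..8}"
    using l i by (rule index_split)
  let ?j = "n - i" and ?Z = "factor_set (Suc (n - i)) p \<union> factor_set 0 r"
  have mem: "p @ [code f1 g1 h1, code f0 g0 h0] @ r \<in> indices n" for f1 g1 h1 f0 g0 h0
    using len i sets code_range by (auto simp: indices_def)
  have S_at: "S_at i (bvec l) =
      (\<Sum>(a, f1, f0) \<leftarrow> crossing_terms f' f. \<Sum>(b, g1, g0) \<leftarrow> crossing_terms g' g. \<Sum>(c, h1, h0) \<leftarrow> crossing_terms h' h.
        scale (a * b * c) (bvec (p @ [code f1 g1 h1, code f0 g0 h0] @ r)))"
    unfolding l_eq S_at_bvec[OF len(1)] S_bvec_code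
    by (simp add: lin_ext_sum_list lin_ext_scale case_prod_unfold)
  show in_V: "S_at i (bvec l) \<in> tensor_power n"
    unfolding S_at tensor_power_eq case_prod_unfold
    by (intro free_space_sum_list free_space_scale) (use mem in simp)
  have crossing: "factor_set 0 (p @ [code f1 g1 h1, code f0 g0 h0] @ r) =
      at_crossing ?j ?Z f1 g1 h1 f0 g0 h0" for f1 g1 h1 f0 g0 h0
    by (rule factor_set_crossing) (rule len(2))
  have j: "1 \<le> ?j" "?j < n" using i by auto
  have Z: "c ?j \<notin> ?Z" "c (Suc ?j) \<notin> ?Z" if "c \<in> {Fg, Gg, Hg}" for c
    using that len(2) strand_factor_set[of "c ?j" "Suc ?j" p] strand_factor_set[of "c ?j" 0 r]
      strand_factor_set[of "c (Suc ?j)" "Suc ?j" p] strand_factor_set[of "c (Suc ?j)" 0 r] by auto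
  have sub: "at_crossing ?j ?Z f' g' h' f g h \<subseteq> gens n"
    using factor_set_subset_gens[of l] l unfolding l_eq crossing by (simp add: indices_def)
  have "I_map n (S_at i (bvec l)) =
      (\<Sum>(a, f1, f0) \<leftarrow> crossing_terms f' f. \<Sum>(b, g1, g0) \<leftarrow> crossing_terms g' g. \<Sum>(c, h1, h0) \<leftarrow> crossing_terms h' h.
        scale (a * b * c) (bvec (at_crossing ?j ?Z f1 g1 h1 f0 g0 h0)))"
    using in_V n
    by (simp only: I_map_eq restrict_apply' S_at lin_ext_sum_list lin_ext_scale case_prod_unfold lin_ext_bvec
        crossing)
  also have "\<dots> = Phi n (sigma n ?j) (bvec (at_crossing ?j ?Z f' g' h' f g h))"
    by (rule Phi_sigma_at_crossing[symmetric]) (fact j sub Z)+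
  also have "bvec (at_crossing ?j ?Z f' g' h' f g h) = I_map n (bvec l)"
    using I_map_bvec[OF n l] unfolding l_eq crossing by simp
  finally show "I_map n (S_at i (bvec l)) = Phi n (sigma n ?j) (I_map n (bvec l))" .
qed

text \<open>The right-hand side is a homomorphism in \<open>b\<close>, being composed of \<open>hat\<close>, \<open>\<Phi>\<^sub>n\<close> and a conjugation,
  and it has the prescribed values on the generators. By \<open>braid_lift_unique\<close> it is \<open>bS n\<close>.\<close>

lemma bS_eq_conjugate:
  assumes n: "n \<ge> 1" and b: "b \<in> carrier (braid_group n)"
  shows "bS n b = restrict (\<lambda>v. inv_into (tensor_power n) (I_map n) (Phi n (hat n b) (I_map n v))) (tensor_power n)"
proof -
  let ?V = "tensor_power n" and ?I = "I_map n" and ?B = "braid_group n"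
  let ?J = "inv_into ?V ?I"
  define k where "k T = restrict (\<lambda>v. ?J (T (?I v))) ?V" for T
  have k: "k \<in> hom (GL (exterior n)) (GL ?V)"
    unfolding k_def tensor_power_eq exterior_eq
    using I_map_bij[OF n] I_map_linear[OF n]
    by (intro conjugation_hom) (simp_all only: tensor_power_eq exterior_eq)
  have "k \<circ> Phi n \<circ> hat n \<in> hom ?B (GL ?V)"
    using Group.hom_compose[OF hat_hom Group.hom_compose[OF Phi_hom k]] by (simp add: comp_assoc)
  moreover have "restrict (S_at i) ?V = (k \<circ> Phi n \<circ> hat n) (sigma n i)" if i: "1 \<le> i" "i < n" for i
  proof -
    have Phi: "Phi n (sigma n (n - i)) \<in> carrier (GL (exterior n))"
      using Phi_hom by (rule hom_carrier[THEN subsetD, OF _ imageI]) (use i in \<open>simp add: sigma_carrier\<close>)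
    have lin: "linear_on ?V (S_at i)"
      unfolding S_at_def tensor_map_def by (rule linear_on_lin_ext)
    have klin: "linear_on ?V (k (Phi n (sigma n (n - i))))"
      using hom_carrier[OF k] Phi GL_linear by blast
    have "S_at i v = k (Phi n (sigma n (n - i))) v" if v: "v \<in> ?V" for v
    proof (rule linear_on_eqI[of "indices n" "S_at i" "k (Phi n (sigma n (n - i)))"])
      fix l assume l: "l \<in> indices n"
      have "k (Phi n (sigma n (n - i))) (bvec l) = ?J (?I (S_at i (bvec l)))"
        using l S_at_intertwined(2)[OF i l] by (simp add: k_def tensor_power_eq)
      also have "\<dots> = S_at i (bvec l)"
        by (rule bij_betw_inv_into_left[OF I_map_bij[OF n] S_at_intertwined(1)[OF i l]])
      finally show "S_at i (bvec l) = k (Phi n (sigma n (n - i))) (bvec l)" ..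
    qed (use lin klin v in \<open>simp_all add: tensor_power_eq\<close>)
    then show ?thesis
      using i by (auto simp: hat_sigma k_def restrict_def)
  qed
  ultimately have "braid_lift (GL ?V) (\<lambda>i. restrict (S_at i) ?V) b = (k \<circ> Phi n \<circ> hat n) b"
    using b group_GL[of "indices n"] by (intro braid_lift_unique) (simp_all only: tensor_power_eq)
  then show ?thesis by (simp add: bS_def S_at_def k_def)
qed

theorem theorem4p5:
  fixes n :: nat and b :: "(nat \<times> bool) list set"
  assumes "n \<ge> 1" and "b \<in> carrier (braid_group n)"
  shows "compose (tensor_power n) (Phi n b) (I_map n)
       = compose (tensor_power n) (I_map n) (bS n (hat n b))"
proof -
  let ?V = "tensor_power n" and ?I = "I_map n"
  have bij: "bij_betw ?I ?V (exterior n)" using assms(1) by (rule I_map_bij)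
  have Phi: "Phi n b \<in> carrier (GL (exterior n))"
    using Phi_hom assms(2) by (rule hom_carrier[THEN subsetD, OF _ imageI])
  have "?I (bS n (hat n b) v) = Phi n b (?I v)" if v: "v \<in> ?V" for v
  proof -
    have "Phi n b (?I v) \<in> exterior n"
      using Phi bij_betw_apply[OF bij v] by (rule GL_maps)
    then show ?thesis
      using v bij_betw_inv_into_right[OF bij]
      by (simp add: bS_eq_conjugate[OF assms(1) hat_carrier[OF assms(2)]] hat_hat[OF assms(2)])
  qed
  then show ?thesis by (auto simp: compose_def restrict_def)
qed

end
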